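(* Suppose $(W,S)$ is the Coxeter system of type $\tilde A_2$. Then for all $y\in W$ such that $P_{x,y}=1$ whenever $x\le y$ (there are infinitely many such $y$), the Bruhat graph $[1,y]_{\mathcal B}$ for $[1,y]$ can be cubulated.
   Context: Let $(W,S)$ be a Coxeter system with word length $\ell$, set of reflections $\mathcal T=\{xsx^{-1}: x\in W, s\in S\}$, and Bruhat order $\le$ (generated by $x\le xt$ for $x\in W$, $t\in\mathcal T$, $\ell(xt)>\ell(x)$). For $x\le y$, $[x,y]=\{z\in W: x\le z\le y\}$. Type $\tilde A_2$ means $S=\{s_0,s_1,s_2\}$ with $m(s_i,s_j)=3$ for all $i\ne j$. Bruhat graph: $\mathcal B$ is the directed graph with vertex set $W$ and an edge from $x$ to $xt$, for $t\in\mathcal T$, if and only if $\ell(xt)>\ell(x)$. The graph $[x,y]_{\mathcal B}$ is the subgraph of $\mathcal B$ induced by the vertex set $[x,y]$. Cubical lattice: for an integer $N\ge 1$ and $k_1,\dots,k_N\in\mathbb N=\{0,1,2,\dots\}$, $\mathcal C(k_1,\dots,k_N)$ is the directed graph with vertex set $\{(m_1,\dots,m_N)\in\mathbb Z^N: 0\le m_i\le k_i \text{ for all } i\}$ and an edge from $u$ to $v$ if and only if $v-u$ is a standard basis vector of $\mathbb Z^N$. A cubical lattice is any directed graph isomorphic to some $\mathcal C(k_1,\dots,k_N)$. Cubulation: a directed graph $\mathcal D$ can be cubulated if some cubical lattice is isomorphic to a spanning subgraph of $\mathcal D$ (a subgraph, not necessarily induced, with the same vertex set as $\mathcal D$). The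 Kazhdan--Lusztig polynomials $P_{x,y}=P_{x,y}(q)\in\mathbb Z[q]$ are in the standard (original) normalization: $P_{x,y}=0$ if $x\not\le y$, $P_{y,y}=1$, and $\deg P_{x,y}\le(\ell(y)-\ell(x)-1)/2$ for $x<y$. *)

theory Defs
  imports
    "HOL-Algebra.Multiplicative_Group"
    "HOL-Computational_Algebra.Polynomial"
    "Graph_Theory.Graph_Theory"
begin

section \<open>Coxeter systems\<close>

definition word_prod :: "('a, 'b) monoid_scheme \<Rightarrow> 'a list \<Rightarrow> 'a" where
  "word_prod W ws = foldr (\<lambda>s x. s \<otimes>\<^bsub>W\<^esub> x) ws \<one>\<^bsub>W\<^esub>"

text \<open>
  One application, inside a word over \<open>S\<close>, of the relation \<open>(s t)\<^sup>m = 1\<close> where \<open>m\<close> is the order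
  of \<open>s t\<close> in \<open>W\<close>. Since \<open>group.ord\<close> is \<open>0\<close> for elements of infinite order, no relation is
  imposed on such a pair.
\<close>

inductive coxeter_step :: "('a, 'b) monoid_scheme \<Rightarrow> 'a set \<Rightarrow> 'a list \<Rightarrow> 'a list \<Rightarrow> bool"
  for W (structure) and S where
  "\<lbrakk>s \<in> S; t \<in> S; us \<in> lists S; vs \<in> lists S\<rbrakk> \<Longrightarrow>
    coxeter_step W S (us @ concat (replicate (group.ord W (s \<otimes> t)) [s, t]) @ vs) (us @ vs)"

text \<open>
  \<open>W\<close> has the presentation with generators \<open>S\<close> and relations \<open>(s t)\<^sup>m = 1\<close>. Words in the generators
  without inverses suffice because the relations with \<open>s = t\<close> say \<open>s s = 1\<close>; so the last
  conjunct says that the group with this presentation maps injectively to \<open>W\<close>.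
\<close>

definition coxeter_system :: "('a, 'b) monoid_scheme \<Rightarrow> 'a set \<Rightarrow> bool" where
  "coxeter_system W S \<longleftrightarrow>
    group W \<and> S \<subseteq> carrier W \<and> generate W S = carrier W \<and>
    (\<forall>s\<in>S. group.ord W s = 2) \<and>
    (\<forall>ws\<in>lists S. word_prod W ws = \<one>\<^bsub>W\<^esub> \<longrightarrow> equivclp (coxeter_step W S) ws [])"

definition type_A2_tilde :: "('a, 'b) monoid_scheme \<Rightarrow> 'a set \<Rightarrow> bool" where
  "type_A2_tilde W S \<longleftrightarrow>
    card S = 3 \<and> (\<forall>s\<in>S. \<forall>t\<in>S. s \<noteq> t \<longrightarrow> group.ord W (s \<otimes>\<^bsub>W\<^esub> t) = 3)"

definition word_length :: "('a, 'b) monoid_scheme \<Rightarrow> 'a set \<Rightarrow> 'a \<Rightarrow> nat" where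
  "word_length W S x = (LEAST n. \<exists>ws\<in>lists S. length ws = n \<and> word_prod W ws = x)"

definition reflections :: "('a, 'b) monoid_scheme \<Rightarrow> 'a set \<Rightarrow> 'a set" where
  "reflections W S = {x \<otimes>\<^bsub>W\<^esub> s \<otimes>\<^bsub>W\<^esub> inv\<^bsub>W\<^esub> x | x s. x \<in> carrier W \<and> s \<in> S}"

section \<open>Bruhat graph and Bruhat order\<close>

definition bruhat_graph :: "('a, 'b) monoid_scheme \<Rightarrow> 'a set \<Rightarrow> ('a, 'a \<times> 'a) pre_digraph" where
  "bruhat_graph W S = with_proj
    \<lparr>pverts = carrier W,
     parcs = {(x, x \<otimes>\<^bsub>W\<^esub> t) | x t. x \<in> carrier W \<and> t \<in> reflections W S \<and>
       word_length W S x < word_length W S (x \<otimes>\<^bsub>W\<^esub> t)}\<rparr>"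

definition bruhat_le :: "('a, 'b) monoid_scheme \<Rightarrow> 'a set \<Rightarrow> 'a \<Rightarrow> 'a \<Rightarrow> bool" where
  "bruhat_le W S x y \<longleftrightarrow> reachable (bruhat_graph W S) x y"

definition bruhat_interval :: "('a, 'b) monoid_scheme \<Rightarrow> 'a set \<Rightarrow> 'a \<Rightarrow> 'a \<Rightarrow> 'a set" where
  "bruhat_interval W S x y = {z. bruhat_le W S x z \<and> bruhat_le W S z y}"

definition bruhat_interval_graph ::
    "('a, 'b) monoid_scheme \<Rightarrow> 'a set \<Rightarrow> 'a \<Rightarrow> 'a \<Rightarrow> ('a, 'a \<times> 'a) pre_digraph" where
  "bruhat_interval_graph W S x y = induce_subgraph (bruhat_graph W S) (bruhat_interval W S x y)"

section \<open>Kazhdan--Lusztig polynomials\<close>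

text \<open>
  As in Bjoerner and Brenti, \<^emph>\<open>Combinatorics of Coxeter Groups\<close>, Theorems 5.1.1 and 5.1.4: the
  \<open>R\<close>-polynomials (the coefficients of the bar involution of the Hecke algebra) and the
  Kazhdan--Lusztig polynomials are each the unique family with the listed properties.
  The indeterminate \<open>q\<close> is \<open>[:0, 1:]\<close>.
\<close>

definition is_R_family ::
    "('a, 'b) monoid_scheme \<Rightarrow> 'a set \<Rightarrow> ('a \<Rightarrow> 'a \<Rightarrow> int poly) \<Rightarrow> bool" where
  "is_R_family W S R \<longleftrightarrow>
    (\<forall>u v. \<not> bruhat_le W S u v \<longrightarrow> R u v = 0) \<and>
    (\<forall>u\<in>carrier W. R u u = 1) \<and>
    (\<forall>u\<in>carrier W. \<forall>v\<in>carrier W. \<forall>s\<in>S.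
      word_length W S (v \<otimes>\<^bsub>W\<^esub> s) < word_length W S v \<longrightarrow>
      R u v =
        (if word_length W S (u \<otimes>\<^bsub>W\<^esub> s) < word_length W S u
         then R (u \<otimes>\<^bsub>W\<^esub> s) (v \<otimes>\<^bsub>W\<^esub> s)
         else [:0, 1:] * R (u \<otimes>\<^bsub>W\<^esub> s) (v \<otimes>\<^bsub>W\<^esub> s) + ([:0, 1:] - 1) * R u (v \<otimes>\<^bsub>W\<^esub> s)))"

definition R_polynomial :: "('a, 'b) monoid_scheme \<Rightarrow> 'a set \<Rightarrow> 'a \<Rightarrow> 'a \<Rightarrow> int poly" where
  "R_polynomial W S = (THE R. is_R_family W S R)"

text \<open>
  \<open>q_reverse n p\<close> is \<open>q\<^sup>n p(1/q)\<close>, for \<open>n\<close> at least the degree of \<open>p\<close>; the degree bound in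
  \<open>is_KL_family\<close> ensures this wherever it is used.
\<close>

definition q_reverse :: "nat \<Rightarrow> int poly \<Rightarrow> int poly" where
  "q_reverse n p = Polynomial.monom 1 (n - Polynomial.degree p) * reflect_poly p"

definition is_KL_family ::
    "('a, 'b) monoid_scheme \<Rightarrow> 'a set \<Rightarrow> ('a \<Rightarrow> 'a \<Rightarrow> int poly) \<Rightarrow> bool" where
  "is_KL_family W S P \<longleftrightarrow>
    (\<forall>u v. \<not> bruhat_le W S u v \<longrightarrow> P u v = 0) \<and>
    (\<forall>u\<in>carrier W. P u u = 1) \<and>
    (\<forall>u v. bruhat_le W S u v \<and> u \<noteq> v \<longrightarrow>
      2 * int (Polynomial.degree (P u v)) \<le> int (word_length W S v) - int (word_length W S u) - 1) \<and>
    (\<forall>u v. bruhat_le W S u v \<longrightarrow>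
      q_reverse (word_length W S v - word_length W S u) (P u v) =
        (\<Sum>a\<in>bruhat_interval W S u v. R_polynomial W S u a * P a v))"

definition KL_polynomial :: "('a, 'b) monoid_scheme \<Rightarrow> 'a set \<Rightarrow> 'a \<Rightarrow> 'a \<Rightarrow> int poly" where
  "KL_polynomial W S = (THE P. is_KL_family W S P)"

section \<open>Cubulations\<close>

text \<open>
  The vertices \<open>(m\<^sub>1, \<dots>, m\<^sub>N)\<close> are lists of length \<open>N\<close>, where \<open>N\<close> is the length of the parameter
  list \<open>ks = [k\<^sub>1, \<dots>, k\<^sub>N]\<close>.
\<close>

definition cubical_verts :: "nat list \<Rightarrow> int list set" where
  "cubical_verts ks =
    {m. length m = length ks \<and> (\<forall>i<length ks. 0 \<le> m ! i \<and> m ! i \<le> int (ks ! i))}"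

definition cubical_lattice :: "nat list \<Rightarrow> (int list, int list \<times> int list) pre_digraph" where
  "cubical_lattice ks = with_proj
    \<lparr>pverts = cubical_verts ks,
     parcs = {(u, v). u \<in> cubical_verts ks \<and> v \<in> cubical_verts ks \<and>
       (\<exists>i<length ks. v = u[i := u ! i + 1])}\<rparr>"

definition can_be_cubulated :: "('a, 'a \<times> 'a) pre_digraph \<Rightarrow> bool" where
  "can_be_cubulated D \<longleftrightarrow>
    (\<exists>ks H. ks \<noteq> [] \<and> spanning H D \<and> digraph_iso (cubical_lattice ks) H)"

end

theory Submission
  imports Defs
begin

text \<open>
  Sending \<open>w\<close> to the image of the base alcove under \<open>w\<inverse>\<close> identifies the group with the alcoves of
  the plane, right multiplication by a reflection with a reflection in a line \<open>x\<^sub>i = n\<close>, and length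
  with the sum of the absolute values of the three floor coordinates.

  If \<open>P\<^sub>x\<^sub>,\<^sub>y = 1\<close> for all \<open>x \<le> y\<close>, differentiating \<open>q\<^bsup>l(y) - l(u)\<^esup> = \<Sum>a. R\<^sub>u\<^sub>,\<^sub>a\<close> at \<open>q = 1\<close> shows that
  every \<open>u \<le> y\<close> has exactly \<open>l(y) - l(u)\<close> Bruhat arcs into the interval. Up to diagram automorphisms
  this leaves six sporadic elements and the spiral elements \<open>(-k, -1, k)\<close> of length \<open>2k + 1\<close>, whose
  lower intervals are triangles \<open>T\<^sub>k\<close> of alcoves, of Poincare polynomial \<open>[3][k][k + 1]\<close>; these are
  cubulated by \<open>C(2, k - 1, k)\<close>.

  Conversely the spiral elements are rationally smooth because the indicator function of \<open>T\<^sub>k\<close> is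
  invariant under the bar involution. This follows by induction from a recursion for these functions
  that mirrors the one for complete symmetric polynomials in three variables.
\<close>

text \<open>Both families of polynomials are given by definite descriptions, so nothing can be said
  of them before existence and uniqueness are known. The obstacle is the existence of R: its
  recursion may use any descent of \<open>v\<close>, and independence of the choice is Matsumoto's
  theorem. The same theorem produces the map from alcoves back to the group, while the map to
  alcoves rests on the presentation. The derivative at 1 counts arcs because R(1) is 1 on the
  diagonal and 0 elsewhere, while R'(1) is 1 on Bruhat arcs and 0 elsewhere. For the classification,
  one \<open>u\<close> with too many arcs below \<open>y\<close> refutes each excluded family. The
  sides of C(2, k - 1, k) come from the Poincare polynomial: its factors [3], [k], [k + 1] are the
  rank generating functions of chains with 3, k and k + 1 vertices. The recursion for the triangle
  functions contains a minus sign. This is harmless, since bar invariance is preserved by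
  differences; so the Hecke element of a triangle need not be factored.\<close>

datatype node = N0 | N1 | N2

lemma UNIV_node: "(UNIV :: node set) = {N0, N1, N2}"
proof -
  have "x \<in> {N0, N1, N2}" for x
    by (cases x) auto
  then show ?thesis by auto
qed

lemma all_node: "(\<forall>i. P i) \<longleftrightarrow> P N0 \<and> P N1 \<and> P N2"
  by (metis node.exhaust)

instance node :: finite
  by standard (simp add: UNIV_node)

text \<open>The value on equal arguments is a default; it keeps \<open>third\<close> equivariant
  under all permutations of the indices.\<close>

fun third :: "node \<Rightarrow> node \<Rightarrow> node" where
  "third N0 N1 = N2" | "third N1 N0 = N2" | "third N0 N2 = N1" | "third N2 N0 = N1"
| "third N1 N2 = N0" | "third N2 N1 = N0" | "third i _ = i"

section \<open>Alcoves, reflections and length in coordinates\<close>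

datatype alcove = Alcove int int bool

text \<open>
  An alcove is given by the floors of the barycentric coordinates \<open>x\<^sub>0 + x\<^sub>1 + x\<^sub>2 = 1\<close> of its
  points. The floors of \<open>x\<^sub>0\<close> and \<open>x\<^sub>1\<close> determine that of \<open>x\<^sub>2\<close> up to the Boolean, since the three
  floors add up to \<open>0\<close> or \<open>-1\<close>.
\<close>

fun coord :: "node \<Rightarrow> alcove \<Rightarrow> int" where
  "coord N0 (Alcove a b e) = a"
| "coord N1 (Alcove a b e) = b"
| "coord N2 (Alcove a b e) = - a - b - of_bool e"

text \<open>The reflection in the line \<open>x\<^sub>i = n\<close>.\<close>

fun mirror :: "node \<Rightarrow> int \<Rightarrow> alcove \<Rightarrow> alcove" where
  "mirror N0 n (Alcove a b e) = Alcove (2 * n - 1 - a) (a + b + of_bool e - n) (\<not> e)"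
| "mirror N1 n (Alcove a b e) = Alcove (a + b + of_bool e - n) (2 * n - 1 - b) (\<not> e)"
| "mirror N2 n (Alcove a b e) = Alcove (- n - b) (- n - a) (\<not> e)"

text \<open>The base alcove has floors 0, so the absolute value of \<open>coord i a\<close> is the
  number of lines x_i = n that separate \<open>a\<close> from it.\<close>

definition len :: "alcove \<Rightarrow> nat" where
  "len a = nat (\<bar>coord N0 a\<bar> + \<bar>coord N1 a\<bar> + \<bar>coord N2 a\<bar>)"

abbreviation "base_alcove \<equiv> Alcove 0 0 False"

abbreviation simple :: "node \<Rightarrow> alcove \<Rightarrow> alcove" where
  "simple i \<equiv> mirror i 0"

lemma alcove_eq_iff: "a = b \<longleftrightarrow> (\<forall>i. coord i a = coord i b)"
  by (cases a; cases b) (auto simp: all_node)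

text \<open>The reflection sends x_i to 2n - x_i and adds x_i - n to the other two coordinates,
  which turns x_j into 1 - n - x_k. Off the lines, the floor of -x is -1 minus the floor of
  x.\<close>

lemma coord_mirror:
  "coord j (mirror i n a) = (if i = j then 2 * n - 1 - coord i a else - n - coord (third i j) a)"
  by (cases a; cases i; cases j) auto

lemma coord_sum: "coord N0 a + coord N1 a + coord N2 a \<in> {0, -1}"
  by (cases a) auto

lemma mirror_mirror [simp]: "mirror i n (mirror i n a) = a"
  by (cases a; cases i) auto

lemma mirror_neq [simp]: "mirror i n a \<noteq> a" "a \<noteq> mirror i n a"
  by (cases a; cases i; auto)+

lemma mirror_eq_iff: "mirror i n a = b \<longleftrightarrow> a = mirror i n b"
  by (metis mirror_mirror)

lemma simple_mirror:
  "simple i (mirror j n a) =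
    (if i = j then mirror i (- n) (simple i a) else mirror (third i j) (1 - n) (simple i a))"
  by (cases a; cases i; cases j) auto

lemma simple_braid: "i \<noteq> j \<Longrightarrow> simple i (simple j (simple i a)) = simple j (simple i (simple j a))"
  by (cases a; cases i; cases j) auto

lemma mirror_inj: "mirror i n a = mirror j m a \<longleftrightarrow> i = j \<and> n = m"
proof
  assume eq: "mirror i n a = mirror j m a"
  have "i = j"
  proof (rule ccontr)
    assume "i \<noteq> j"
    then have "2 * n - 1 - coord i a = - m - coord (third i j) a"
        "- n - coord (third i j) a = 2 * m - 1 - coord j a"
      using arg_cong[OF eq, of "coord i"] arg_cong[OF eq, of "coord j"]
      by (cases i; cases j; simp add: coord_mirror)+
    moreover have "coord i a + coord j a + coord (third i j) a = 0 \<or>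
        coord i a + coord j a + coord (third i j) a = - 1"
      using coord_sum[of a] \<open>i \<noteq> j\<close> by (cases i; cases j) auto
    \<comment> \<open>The two equations add up to c_i + c_j - 2 c_k = 3 (n + m) - 2, which is 1
      modulo 3, whereas the floor sum makes the left side 0 or 2 modulo 3.\<close>
    ultimately show False by presburger
  qed
  then show "i = j \<and> n = m"
    using arg_cong[OF eq, of "coord i"] by (simp add: coord_mirror)
qed simp

lemma int_len: "int (len a) = \<bar>coord N0 a\<bar> + \<bar>coord N1 a\<bar> + \<bar>coord N2 a\<bar>"
  by (simp add: len_def)

text \<open>A reflection lengthens exactly the alcoves on the same side of its line as the base
  alcove, and that side is x_i < n if and only if \<open>n \<ge> 1\<close>.\<close>

lemma len_mirror:
  "len a < len (mirror i n a) \<longleftrightarrow> (if n \<ge> 1 then coord i a < n else coord i a \<ge> n)"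
proof -
  have *: "\<bar>x\<bar> + \<bar>y\<bar> + \<bar>z\<bar> < \<bar>2 * n - 1 - x\<bar> + \<bar>- n - z\<bar> + \<bar>- n - y\<bar> \<longleftrightarrow>
      (if n \<ge> 1 then x < n else x \<ge> n)"
    if "x + y + z = 0 \<or> x + y + z = - 1" for x y z :: int
    using that by (cases "n \<ge> 1"; cases "x \<ge> 0"; cases "y \<ge> 0"; cases "z \<ge> 0") auto
  have "int (len a) < int (len (mirror i n a)) \<longleftrightarrow> (if n \<ge> 1 then coord i a < n else coord i a \<ge> n)"
    using coord_sum[of a] *[of "coord N0 a" "coord N1 a" "coord N2 a"]
      *[of "coord N1 a" "coord N0 a" "coord N2 a"] *[of "coord N2 a" "coord N0 a" "coord N1 a"]
    unfolding int_len by (cases i) (auto simp: coord_mirror algebra_simps)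
  then show ?thesis by simp
qed

lemma len_simple:
  "len (simple i a) = (if coord i a \<ge> 0 then len a + 1 else len a - 1)" (is ?A)
  and len_pos: "coord i a < 0 \<Longrightarrow> len a > 0" (is "_ \<Longrightarrow> ?B")
proof -
  have *: "\<bar>- 1 - x\<bar> + \<bar>- z\<bar> + \<bar>- y\<bar> = \<bar>x\<bar> + \<bar>y\<bar> + \<bar>z\<bar> + (if x \<ge> 0 then 1 else - 1)" for x y z :: int
    by auto
  have "int (len (simple i a)) = int (len a) + (if coord i a \<ge> 0 then 1 else - 1)"
    using *[of "coord N0 a" "coord N1 a" "coord N2 a"]
      *[of "coord N1 a" "coord N0 a" "coord N2 a"] *[of "coord N2 a" "coord N0 a" "coord N1 a"]
    unfolding int_len by (cases i) (auto simp: coord_mirror)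
  then show ?A by (simp split: if_splits)
  show ?B if "coord i a < 0"
    using that by (cases i) (auto simp: len_def)
qed

lemma descent_iff: "len (simple i a) < len a \<longleftrightarrow> coord i a < 0"
  using len_simple[of i a] len_pos[of i a] by auto

lemma ascent_iff: "len a < len (simple i a) \<longleftrightarrow> coord i a \<ge> 0"
  using len_simple[of i a] by auto

lemma coord_simple_neg_iff: "coord i (simple i a) < 0 \<longleftrightarrow> \<not> coord i a < 0"
  by (auto simp: coord_mirror)

lemma len_base [simp]: "len base_alcove = 0"
  by (simp add: len_def)

lemma ex_descent: "a \<noteq> base_alcove \<Longrightarrow> \<exists>i. coord i a < 0"
proof (rule ccontr)
  assume ne: "a \<noteq> base_alcove" and "\<not> (\<exists>i. coord i a < 0)"
  then have "coord N0 a \<ge> 0" "coord N1 a \<ge> 0" "coord N2 a \<ge> 0"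
    by (auto simp: not_less)
  then have "coord N0 a = 0 \<and> coord N1 a = 0 \<and> coord N2 a = 0"
    using coord_sum[of a] by auto
  then show False using ne by (simp add: alcove_eq_iff all_node)
qed

lemma len_eq_0_iff [simp]: "len a = 0 \<longleftrightarrow> a = base_alcove"
  using ex_descent[of a] len_pos[of _ a] len_base by force

lemma finite_len_le: "finite {a. len a \<le> n}"
proof (rule finite_subset)
  show "{a. len a \<le> n} \<subseteq>
      (\<lambda>(x, y, e). Alcove x y e) ` ({- int n..int n} \<times> {- int n..int n} \<times> UNIV)"
  proof
    fix a assume a: "a \<in> {a. len a \<le> n}"
    obtain x y e where "a = Alcove x y e" by (cases a)
    then show "a \<in> (\<lambda>(x, y, e). Alcove x y e) ` ({- int n..int n} \<times> {- int n..int n} \<times> UNIV)"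
      using a by (intro image_eqI[of _ _ "(x, y, e)"]) (auto simp: len_def)
  qed
qed simp

section \<open>Bruhat order\<close>

definition arc :: "alcove \<Rightarrow> alcove \<Rightarrow> bool" where
  "arc a b \<longleftrightarrow> (\<exists>i n. b = mirror i n a) \<and> len a < len b"

abbreviation ble :: "alcove \<Rightarrow> alcove \<Rightarrow> bool" where
  "ble \<equiv> arc\<^sup>*\<^sup>*"

text \<open>The base alcove and its image under \<open>simple i\<close> are separated by the line
  x_i = 0 only. So \<open>simple i\<close> preserves the direction of every arc except those that
  cross this line.\<close>

lemma arc_simple:
  assumes "arc a b" "b \<noteq> simple i a"
  shows "arc (simple i a) (simple i b)"
proof -
  obtain j n where b: "b = mirror j n a" and l: "len a < len b"
    using assms(1) by (auto simp: arc_def)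
  have "len (simple i a) < len (simple i b)"
  proof (cases "i = j")
    case True
    then have "n \<noteq> 0" using assms(2) b by auto
    then show ?thesis using l True unfolding b
      by (auto simp: simple_mirror len_mirror coord_mirror split: if_splits)
  next
    case False
    then have "third i (third i j) = j" "third i j \<noteq> i" by (cases i; cases j; simp)+
    then show ?thesis using l False unfolding b
      by (auto simp: simple_mirror len_mirror coord_mirror split: if_splits)
  qed
  moreover have "\<exists>k m. simple i b = mirror k m (simple i a)"
    unfolding b simple_mirror by auto
  ultimately show ?thesis by (auto simp: arc_def)
qed

lemma arc_len: "arc a b \<Longrightarrow> len a < len b"
  by (simp add: arc_def)

lemma ble_len: "ble a b \<Longrightarrow> a = b \<or> len a < len b"
  by (induction rule: rtranclp_induct) (auto dest: arc_len)

lemma ble_antisym: "ble a b \<Longrightarrow> ble b a \<Longrightarrow> a = b"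
  using ble_len[of a b] ble_len[of b a] by auto

lemma ble_len_le: "ble a b \<Longrightarrow> len a \<le> len b"
  using ble_len[of a b] by auto

lemma finite_ble: "finite {a. ble a v}"
  by (rule finite_subset[OF Collect_mono finite_len_le[of "len v"]]) (intro impI, erule ble_len_le)

lemma ble_base_iff: "ble a base_alcove \<longleftrightarrow> a = base_alcove"
  using ble_len[of a base_alcove] by auto

lemma arc_descent: "coord i a < 0 \<Longrightarrow> arc (simple i a) a"
  unfolding arc_def descent_iff by (metis mirror_mirror)

lemma arc_ascent: "coord i a \<ge> 0 \<Longrightarrow> arc a (simple i a)"
  unfolding arc_def ascent_iff by auto

lemma base_ble: "ble base_alcove a"
proof (induction "len a" arbitrary: a rule: less_induct)
  case less
  show ?case
  proof (cases "a = base_alcove")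
    case False
    then obtain i where i: "coord i a < 0" using ex_descent by blast
    then have "ble base_alcove (simple i a)" using less by (simp add: descent_iff)
    then show ?thesis using arc_descent[OF i] by (rule rtranclp.rtrancl_into_rtrancl)
  qed simp
qed

text \<open>The lifting property. Apply \<open>simple i\<close> to the vertices of a path from
  \<open>x\<close> to \<open>y\<close>; at the first step that is itself made by
  \<open>simple i\<close>, the image has already reached the old path and follows it from
  there.\<close>

lemma ble_simple_max:
  assumes "ble x y"
  shows "ble (simple i x) (if coord i y < 0 then y else simple i y)"
  using assms
proof (induction rule: converse_rtranclp_induct)
  case base
  then show ?case using arc_descent by auto
next
  case (step x x')
  let ?m = "if coord i y < 0 then y else simple i y"
  have ym: "ble y ?m" using arc_ascent by auto
  show ?case
  proof (cases "x' = simple i x")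
    case True
    then show ?thesis using step(2) ym by auto
  next
    case False
    then show ?thesis
      using arc_simple[OF step(1)] step(3) by (meson converse_rtranclp_into_rtranclp)
  qed
qed

lemma ble_simple_stable: "ble x y \<Longrightarrow> coord i y < 0 \<Longrightarrow> ble (simple i x) y"
  using ble_simple_max[of x y i] by simp

lemma ble_simple_simple: "ble x y \<Longrightarrow> coord i y \<ge> 0 \<Longrightarrow> ble (simple i x) (simple i y)"
  using ble_simple_max[of x y i] by simp

section \<open>Matsumoto's theorem for alcoves\<close>

lemma two_descents:
  assumes "i \<noteq> j" "coord i a < 0" "coord j a < 0"
  shows "coord j (simple i a) < 0" "coord i (simple j (simple i a)) < 0"
  using assms coord_sum[of a] by (cases i; cases j; auto simp: coord_mirror)+

text \<open>Recursion along an arbitrarily chosen descent. It is generic in \<open>f\<close> because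
  it serves twice: for the R-polynomials and for the map \<open>elt\<close> into the group.\<close>

function matsumoto :: "(node \<Rightarrow> 'x \<Rightarrow> 'x) \<Rightarrow> 'x \<Rightarrow> alcove \<Rightarrow> 'x" where
  "matsumoto f x0 a =
    (if a = base_alcove then x0
     else let i = (SOME i. coord i a < 0) in f i (matsumoto f x0 (simple i a)))"
  by auto
termination
proof (relation "measure (\<lambda>(f, x0, a). len a)", simp)
  fix f :: "node \<Rightarrow> 'x \<Rightarrow> 'x" and x0 a i
  assume "a \<noteq> base_alcove" "i = (SOME i. coord i a < 0)"
  then have "coord i a < 0" by (metis ex_descent someI)
  then show "((f, x0, simple i a), (f, x0, a)) \<in> measure (\<lambda>(f, x0, a). len a)"
    by (simp add: descent_iff)
qed

declare matsumoto.simps [simp del]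

lemma matsumoto_base: "matsumoto f x0 base_alcove = x0"
  by (simp add: matsumoto.simps)

lemma matsumoto_in:
  assumes "x0 \<in> X" "\<And>i x. x \<in> X \<Longrightarrow> f i x \<in> X"
  shows "matsumoto f x0 a \<in> X"
proof (induction "len a" arbitrary: a rule: less_induct)
  case less
  show ?case
  proof (cases "a = base_alcove")
    case False
    define i where "i = (SOME i. coord i a < 0)"
    have "coord i a < 0" unfolding i_def using False by (metis ex_descent someI)
    then have "matsumoto f x0 (simple i a) \<in> X" using less by (simp add: descent_iff)
    then show ?thesis using False assms(2)[of _ i]
      by (subst matsumoto.simps) (simp add: i_def[symmetric] Let_def)
  qed (simp add: matsumoto_base assms(1))
qed

text \<open>If \<open>i\<close> differs from the chosen descent \<open>j\<close>, then by
  \<open>two_descents\<close> both i, j, i and j, i, j can be split off \<open>a\<close>, and the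
  braid relation joins the two results. The set \<open>X\<close> allows the relation to be required
  on the carrier of a group only.\<close>

lemma matsumoto_descent:
  assumes "x0 \<in> X" "\<And>i x. x \<in> X \<Longrightarrow> f i x \<in> X"
    and braid: "\<And>i j x. x \<in> X \<Longrightarrow> i \<noteq> j \<Longrightarrow> f i (f j (f i x)) = f j (f i (f j x))"
  shows "coord i a < 0 \<Longrightarrow> matsumoto f x0 a = f i (matsumoto f x0 (simple i a))"
proof (induction "len a" arbitrary: a i rule: less_induct)
  case less
  let ?F = "matsumoto f x0"
  have ne: "a \<noteq> base_alcove" using less.prems by (cases i) auto
  define j where "j = (SOME j. coord j a < 0)"
  have j: "coord j a < 0" unfolding j_def using ne by (metis ex_descent someI)
  have Fj: "?F a = f j (?F (simple j a))"
    using ne by (subst matsumoto.simps) (simp add: j_def[symmetric] Let_def)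
  show ?case
  proof (cases "i = j")
    case True
    then show ?thesis using Fj by simp
  next
    case False
    have step: "?F (simple k a) = f l (f k (?F (simple k (simple l (simple k a)))))"
      if "k \<noteq> l" "coord k a < 0" "coord l a < 0" for k l
    proof -
      note td = two_descents[OF that]
      have "len (simple k a) < len a" using that by (simp add: descent_iff)
      moreover have "len (simple l (simple k a)) < len (simple k a)" using td by (simp add: descent_iff)
      ultimately show ?thesis using less.hyps td by (metis order.strict_trans)
    qed
    have "?F a = f j (f i (f j (?F (simple j (simple i (simple j a))))))"
      using Fj step[of j i] False j less.prems by simp
    also have "\<dots> = f i (f j (f i (?F (simple j (simple i (simple j a))))))"
      using braid[of "?F (simple j (simple i (simple j a)))" j i] False
        matsumoto_in[of x0 X f, OF assms(1,2)] by simp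
    also have "\<dots> = f i (f j (f i (?F (simple i (simple j (simple i a))))))"
      using simple_braid[OF False, of a] by simp
    also have "\<dots> = f i (?F (simple i a))"
      using step[of i j] False j less.prems by simp
    finally show ?thesis .
  qed
qed

section \<open>R-polynomials\<close>

abbreviation qq :: "int poly" where "qq \<equiv> [:0, 1:]"

text \<open>The R-recursion as an operator on whole columns \<open>\<lambda>u. R u v\<close>, so
  that its consistency becomes a braid relation between operators.\<close>

definition R_step :: "node \<Rightarrow> (alcove \<Rightarrow> int poly) \<Rightarrow> alcove \<Rightarrow> int poly" where
  "R_step i g u =
    (if coord i u < 0 then g (simple i u) else qq * g (simple i u) + (qq - 1) * g u)"

lemma R_step_braid:
  assumes "i \<noteq> j"
  shows "R_step i (R_step j (R_step i g)) = R_step j (R_step i (R_step j g))"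
proof
  fix u
  let ?c = "coord j (simple i u)"
  have c: "coord i (simple j u) = ?c" "coord i (simple j (simple i u)) = coord j u"
      "coord j (simple i (simple j u)) = coord i u"
    using assms by (cases i; cases j; simp add: coord_mirror)+
  have sgn: "coord i u < 0 \<and> coord j u < 0 \<longrightarrow> ?c < 0" "?c < 0 \<longrightarrow> coord i u < 0 \<or> coord j u < 0"
    using assms coord_sum[of u] by (cases i; cases j; auto simp: coord_mirror)+
  show "R_step i (R_step j (R_step i g)) u = R_step j (R_step i (R_step j g)) u"
    using sgn unfolding R_step_def coord_simple_neg_iff c mirror_mirror simple_braid[OF assms, of u]
    by (cases "coord i u < 0"; cases "coord j u < 0"; cases "?c < 0"; simp add: algebra_simps)
qed

definition R :: "alcove \<Rightarrow> alcove \<Rightarrow> int poly" where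
  "R u v = matsumoto R_step (\<lambda>u. of_bool (u = base_alcove)) v u"

lemma R_base: "R u base_alcove = of_bool (u = base_alcove)"
  by (simp add: R_def matsumoto_base)

lemma R_rec:
  assumes "coord i v < 0"
  shows "R u v = (if coord i u < 0 then R (simple i u) (simple i v)
    else qq * R (simple i u) (simple i v) + (qq - 1) * R u (simple i v))"
  using matsumoto_descent[of _ UNIV R_step, OF _ _ _ assms] R_step_braid
  unfolding R_def by (simp add: R_step_def)

lemma alcove_induct [case_names base step]:
  assumes "P base_alcove"
    and "\<And>v i. coord i v < 0 \<Longrightarrow> P (simple i v) \<Longrightarrow> P v"
  shows "P v"
proof (induction "len v" arbitrary: v rule: less_induct)
  case less
  show ?case
  proof (cases "v = base_alcove")
    case False
    then obtain i where "coord i v < 0" using ex_descent by blast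
    then show ?thesis using less assms(2) descent_iff by blast
  qed (simp add: assms(1))
qed

lemma R_support: "R u v \<noteq> 0 \<Longrightarrow> ble u v"
proof (induction v arbitrary: u rule: alcove_induct)
  case base
  then show ?case by (simp add: R_base split: if_splits)
next
  case (step v i)
  have v: "arc (simple i v) v" by (rule arc_descent[OF step(1)])
  have s: "coord i (simple i v) \<ge> 0" using step(1) by (simp add: coord_mirror)
  show ?case
  proof (cases "R (simple i u) (simple i v) = 0")
    case False
    then have "ble (simple i u) (simple i v)" by (rule step(2))
    then show ?thesis using ble_simple_simple[OF _ s] by (metis mirror_mirror)
  next
    case True
    have "R u (simple i v) \<noteq> 0"
    proof
      assume "R u (simple i v) = 0"
      with True have "R u v = 0"
        by (subst R_rec[OF step(1)]) (simp only: if_cancel mult_zero_right add_0_right)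
      then show False using step(3) by contradiction
    qed
    then show ?thesis using step(2) v by (meson rtranclp.rtrancl_into_rtrancl)
  qed
qed

lemma R_refl [simp]: "R v v = 1"
  by (induction v rule: alcove_induct) (simp_all add: R_base R_rec)

lemma poly_R_1: "poly (R u v) 1 = of_bool (u = v)"
proof (induction v arbitrary: u rule: alcove_induct)
  case (step v i)
  then show ?case by (auto simp: R_rec[OF step(1), of u] mirror_eq_iff)
qed (simp add: R_base)

lemma arc_simple_iff: "b \<noteq> simple i a \<Longrightarrow> arc (simple i a) (simple i b) \<longleftrightarrow> arc a b"
  using arc_simple[of a b i] arc_simple[of "simple i a" "simple i b" i] by (auto simp: mirror_eq_iff)

text \<open>Differentiating the recursion at 1 leaves the derivative for \<open>simple i u\<close>,
  \<open>simple i v\<close>, plus 1 exactly when \<open>u = simple i v\<close>. This is the one pair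
  for which \<open>simple i\<close> does not transport arcs.\<close>

lemma poly_pderiv_R_1: "poly (pderiv (R u v)) 1 = of_bool (arc u v)"
proof (induction v arbitrary: u rule: alcove_induct)
  case base
  have "\<not> arc u base_alcove" using arc_len[of u base_alcove] by auto
  then show ?case by (simp add: R_base)
next
  case (step v i)
  show ?case
  proof (cases "u = simple i v")
    case True
    have "\<not> arc v (simple i v)" using arc_len[of v "simple i v"] step(1) descent_iff by force
    moreover have "arc (simple i v) v" by (rule arc_descent[OF step(1)])
    moreover have "\<not> coord i u < 0" using True step(1) by (simp add: coord_mirror)
    ultimately show ?thesis
      using True step(2)[of v] poly_R_1[of v "simple i v"]
      unfolding R_rec[OF step(1), of u] by (simp add: pderiv_add pderiv_mult pderiv_pCons pderiv_diff)
  next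
    case False
    then have "v \<noteq> simple i u" by auto
    from arc_simple_iff[OF this] show ?thesis
      using step(2)[of "simple i u"] poly_R_1[of "simple i u" "simple i v"] poly_R_1[of u "simple i v"] False
      unfolding R_rec[OF step(1), of u]
      by (cases "u = v") (auto simp: pderiv_add pderiv_mult pderiv_pCons pderiv_diff mirror_eq_iff
         dest: arc_len intro: step(1))
  qed
qed

section \<open>Reversal of polynomials and the symmetry of R\<close>

lemma coeff_q_reverse:
  assumes "Polynomial.degree p \<le> n"
  shows "Polynomial.coeff (q_reverse n p) i = (if i \<le> n then Polynomial.coeff p (n - i) else 0)"
  using assms unfolding q_reverse_def
  by (auto simp: coeff_monom_mult coeff_reflect_poly coeff_eq_0 intro!: arg_cong[of _ _ "Polynomial.coeff p"])

lemma q_reverse_0 [simp]: "q_reverse n 0 = 0"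
  by (simp add: q_reverse_def)

lemma q_reverse_mult:
  assumes "Polynomial.degree p \<le> m" "Polynomial.degree r \<le> n"
  shows "q_reverse (m + n) (p * r) = q_reverse m p * q_reverse n r"
proof (cases "p = 0 \<or> r = 0")
  case False
  then have "m + n - Polynomial.degree (p * r) = (m - Polynomial.degree p) + (n - Polynomial.degree r)"
    using assms by (simp add: degree_mult_eq)
  then show ?thesis
    by (simp add: q_reverse_def reflect_poly_mult mult_ac mult_monom)
qed auto

lemma q_reverse_add:
  assumes "Polynomial.degree p \<le> n" "Polynomial.degree r \<le> n"
  shows "q_reverse n (p + r) = q_reverse n p + q_reverse n r"
  using degree_add_le[OF assms] assms by (intro poly_eqI) (simp add: coeff_q_reverse)

lemma q_reverse_sum:
  assumes "\<And>a. a \<in> A \<Longrightarrow> Polynomial.degree (f a) \<le> n"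
  shows "q_reverse n (\<Sum>a\<in>A. f a) = (\<Sum>a\<in>A. q_reverse n (f a))"
proof (cases "finite A")
  case True
  then show ?thesis using assms
    by (induction A rule: finite_induct) (simp_all add: q_reverse_add degree_sum_le)
qed simp

lemma degree_qq_diff_1: "Polynomial.degree (qq - 1) = 1"
  by (simp add: one_pCons)

lemma q_reverse_1 [simp]: "q_reverse 0 1 = 1"
  by (simp add: q_reverse_def)

lemma q_reverse_qq: "q_reverse 2 qq = qq"
  by (simp add: q_reverse_def reflect_poly_def monom_altdef)

lemma q_reverse_qq_diff_1: "q_reverse 1 (qq - 1) = 1 - qq"
  by (simp add: q_reverse_def one_pCons reflect_poly_pCons)

lemma ble_len_less: "ble u v \<Longrightarrow> u \<noteq> v \<Longrightarrow> len u < len v"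
  using ble_len by blast

text \<open>In the recursion, q is its own reversal at formal degree 2 and q - 1 changes sign at
  degree 1; the length differences drop by 2 and by 1 in the corresponding terms. Where the length
  difference is truncated, R vanishes or \<open>u = v\<close>.\<close>

lemma R_reverse:
  "Polynomial.degree (R u v) \<le> len v - len u \<and>
    q_reverse (len v - len u) (R u v) = (-1) ^ (len v - len u) * R u v"
proof (induction v arbitrary: u rule: alcove_induct)
  case base
  show ?case by (cases "u = base_alcove") (simp_all add: R_base)
next
  case (step v i)
  have lv: "len v = Suc (len (simple i v))"
    using step(1) len_simple[of i v] len_pos[OF step(1)] by simp
  show ?case
  proof (cases "R u v = 0 \<or> u = v")
    case True
    then show ?thesis by auto
  next
    case False
    then have uv: "len u < len v" using R_support ble_len_less by blast
    let ?A = "R (simple i u) (simple i v)" and ?B = "R u (simple i v)"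
    show ?thesis
    proof (cases "coord i u < 0")
      case True
      then have "len u = Suc (len (simple i u))"
        using len_simple[of i u] len_pos[OF True] by simp
      then show ?thesis using step(2)[of "simple i u"] lv True by (simp add: R_rec[OF step(1), of u])
    next
      case u: False
      then have lu: "len (simple i u) = Suc (len u)" using len_simple[of i u] by simp
      define n where "n = len v - len u"
      have n: "n > 0" using uv by (simp add: n_def)
      have B: "Polynomial.degree ?B \<le> n - 1" "q_reverse (n - 1) ?B = (-1) ^ (n - 1) * ?B"
        using step(2)[of u] lv n_def by simp_all
      have qB: "Polynomial.degree ((qq - 1) * ?B) \<le> n"
          "q_reverse n ((qq - 1) * ?B) = (-1) ^ n * ((qq - 1) * ?B)"
      proof -
        have d: "Polynomial.degree (qq - 1) \<le> 1" by (simp add: degree_qq_diff_1)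
        have n1: "n = 1 + (n - 1)" using n by simp
        show "Polynomial.degree ((qq - 1) * ?B) \<le> n"
          using degree_mult_le[of "qq - 1" ?B] d B(1) n by linarith
        have "q_reverse n ((qq - 1) * ?B) = (1 - qq) * ((-1) ^ (n - 1) * ?B)"
          by (subst n1, subst q_reverse_mult[OF d B(1)]) (simp only: B q_reverse_qq_diff_1)
        also have "\<dots> = (-1) ^ n * ((qq - 1) * ?B)"
          by (subst (2) n1) (simp add: algebra_simps)
        finally show "q_reverse n ((qq - 1) * ?B) = (-1) ^ n * ((qq - 1) * ?B)" .
      qed
      have qA: "Polynomial.degree (qq * ?A) \<le> n \<and> q_reverse n (qq * ?A) = (-1) ^ n * (qq * ?A)"
      proof (cases "?A = 0")
        case False
        then have "len (simple i u) \<le> len (simple i v)" using R_support ble_len_le by blast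
        then have n2: "n = 2 + (n - 2)" "n - 2 = len (simple i v) - len (simple i u)"
          using lu lv n_def by simp_all
        have A: "Polynomial.degree ?A \<le> n - 2" "q_reverse (n - 2) ?A = (-1) ^ (n - 2) * ?A"
          using step(2)[of "simple i u"] n2(2) by simp_all
        have d: "Polynomial.degree qq \<le> 2" by simp
        have "Polynomial.degree (qq * ?A) \<le> n"
          using degree_mult_le[of qq ?A] A(1) n2 by simp
        moreover have "q_reverse n (qq * ?A) = qq * ((-1) ^ (n - 2) * ?A)"
          by (subst n2, subst q_reverse_mult[OF d A(1)]) (simp only: A q_reverse_qq)
        moreover have "(-1 :: int poly) ^ n = (-1) ^ (n - 2)"
          by (subst n2) (simp add: power_add)
        ultimately show ?thesis by (simp add: mult_ac)
      qed simp
      have "R u v = qq * ?A + (qq - 1) * ?B" using R_rec[OF step(1), of u] u by simp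
      then show ?thesis
        using qA qB degree_add_le[of "qq * ?A" n "(qq - 1) * ?B"]
        by (simp add: n_def[symmetric] q_reverse_add distrib_left)
    qed
  qed
qed

section \<open>The inversion formula for R\<close>

lemma sum_pairs:
  fixes h :: "alcove \<Rightarrow> 'b::comm_monoid_add"
  assumes "finite A" "\<And>a. a \<in> A \<Longrightarrow> simple i a \<in> A"
  shows "sum h A = (\<Sum>a\<in>{a\<in>A. coord i a \<ge> 0}. h a + h (simple i a))"
proof -
  have "{a\<in>A. coord i a < 0} = simple i ` {a\<in>A. coord i a \<ge> 0}"
  proof -
    have "a \<in> simple i ` {a\<in>A. coord i a \<ge> 0}" if "a \<in> A" "coord i a < 0" for a
      using that assms(2) by (intro image_eqI[of _ _ "simple i a"]) (auto simp: coord_mirror)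
    then show ?thesis using assms(2) by (auto simp: coord_mirror)
  qed
  moreover have "inj_on (simple i) X" for X
    by (rule inj_onI) (metis mirror_mirror)
  ultimately have "sum h {a\<in>A. coord i a < 0} = (\<Sum>a\<in>{a\<in>A. coord i a \<ge> 0}. h (simple i a))"
    by (simp add: sum.reindex)
  moreover have "A = {a\<in>A. coord i a \<ge> 0} \<union> {a\<in>A. coord i a < 0}" by auto
  then have "sum h A = sum h {a\<in>A. coord i a \<ge> 0} + sum h {a\<in>A. coord i a < 0}"
    using assms(1) by (metis (no_types, lifting) CollectD IntE equals0I finite_Un mem_Collect_eq not_le sum.union_disjoint)
  ultimately show ?thesis by (simp add: sum.distrib)
qed

text \<open>This says that the bar map is an involution. The set below \<open>v\<close> is stable
  under \<open>simple i\<close> for a descent \<open>i\<close> of \<open>v\<close>, and adding the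
  terms of \<open>a\<close> and \<open>simple i a\<close> reduces the sum to the same sums for
  \<open>simple i v\<close>.\<close>

lemma R_inverse:
  "(\<Sum>a\<in>{a. ble a v}. (-1) ^ len a * R u a * R a v) = (if u = v then (-1) ^ len v else 0)"
proof (induction v arbitrary: u rule: alcove_induct)
  case base
  show ?case by (simp add: ble_base_iff R_base)
next
  case (step v i)
  let ?A = "{a. ble a v}" and ?w = "simple i v"
  define F where "F x y = (\<Sum>a\<in>?A. (-1) ^ len a * R x a * R a y)" for x y
  have Fw: "F x ?w = (if x = ?w then (-1) ^ len ?w else 0)" for x
  proof -
    have "ble ?w v" using arc_descent[OF step(1)] by auto
    then have "{a. ble a ?w} \<subseteq> ?A" by (meson Collect_mono rtranclp_trans)
    then have "F x ?w = (\<Sum>a\<in>{a. ble a ?w}. (-1) ^ len a * R x a * R a ?w)"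
      unfolding F_def using R_support[of _ ?w]
      by (intro sum.mono_neutral_right finite_ble) auto
    then show ?thesis using step(2) by simp
  qed
  have stable: "simple i a \<in> ?A" if "a \<in> ?A" for a
    using that ble_simple_stable[OF _ step(1)] by simp
  have pairs: "F x y = (\<Sum>a\<in>{a\<in>?A. coord i a \<ge> 0}. (-1) ^ len a * R x a * R a y +
      (-1) ^ len (simple i a) * R x (simple i a) * R (simple i a) y)" for x y
    unfolding F_def by (rule sum_pairs[OF finite_ble stable])
  have sgn: "(-1 :: int poly) ^ len (simple i a) = - ((-1) ^ len a)" if "coord i a \<ge> 0" for a
    using that by (simp add: len_simple)
  have R1: "R a v = qq * R (simple i a) ?w + (qq - 1) * R a ?w" "R (simple i a) v = R a ?w"
    if "coord i a \<ge> 0" for a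
    using that R_rec[OF step(1), of a] R_rec[OF step(1), of "simple i a"] by (simp_all add: coord_mirror)
  have lv: "(-1 :: int poly) ^ len v = - ((-1) ^ len ?w)"
    using step(1) len_simple[of i v] len_pos[OF step(1)] by (metis diff_Suc_1 gr0_conv_Suc not_less power_Suc mult_minus1)
  show ?case
  proof (cases "coord i u < 0")
    case False
    have R2: "R u (simple i a) = qq * R (simple i u) a + (qq - 1) * R u a"
        "R (simple i u) (simple i a) = R u a" if "coord i a \<ge> 0" for a
      using that False R_rec[of i "simple i a" u] R_rec[of i "simple i a" "simple i u"]
      by (simp_all add: coord_mirror)
    have "F u v = - qq * F (simple i u) ?w"
      unfolding pairs sum_distrib_left
      by (intro sum.cong refl) (simp add: R1 R2 sgn algebra_simps)
    moreover have "u \<noteq> v" using False step(1) by auto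
    ultimately show ?thesis by (simp add: F_def[symmetric] Fw mirror_eq_iff)
  next
    case True
    have R2: "R u (simple i a) = R (simple i u) a"
        "R (simple i u) (simple i a) = qq * R u a + (qq - 1) * R (simple i u) a" if "coord i a \<ge> 0" for a
      using that True R_rec[of i "simple i a" u] R_rec[of i "simple i a" "simple i u"]
      by (simp_all add: coord_mirror)
    have "F u v = (qq - 1) * F u ?w - F (simple i u) ?w"
      unfolding pairs sum_distrib_left sum_subtractf[symmetric]
      by (intro sum.cong refl) (simp add: R1 R2 sgn algebra_simps)
    moreover have "u \<noteq> ?w" using True step(1) by (auto simp: coord_mirror)
    ultimately show ?thesis by (simp add: F_def[symmetric] Fw mirror_eq_iff lv)
  qed
qed

section \<open>Kazhdan--Lusztig polynomials\<close>

definition ints :: "alcove \<Rightarrow> alcove \<Rightarrow> alcove set" where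
  "ints u v = {a. ble u a \<and> ble a v}"

lemma finite_ints [simp]: "finite (ints u v)"
  using finite_ble[of v] by (rule rev_finite_subset) (auto simp: ints_def)

lemma ints_len: "a \<in> ints u v \<Longrightarrow> len u \<le> len a \<and> len a \<le> len v"
  by (auto simp: ints_def ble_len_le)

text \<open>The Kazhdan-Lusztig conditions never mix different upper ends, so they can be solved and
  tested one \<open>v\<close> at a time.\<close>

definition KL_column :: "alcove \<Rightarrow> (alcove \<Rightarrow> int poly) \<Rightarrow> bool" where
  "KL_column v p \<longleftrightarrow> p v = 1 \<and>
    (\<forall>u. ble u v \<and> u \<noteq> v \<longrightarrow> 2 * Polynomial.degree (p u) < len v - len u) \<and>
    (\<forall>u. ble u v \<longrightarrow> q_reverse (len v - len u) (p u) = (\<Sum>a\<in>ints u v. R u a * p a))"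

text \<open>By induction the reversal of \<open>p u\<close> minus \<open>p u\<close> is known. The
  degree bound keeps the two apart: below half the length difference only \<open>p u\<close>
  contributes.\<close>

lemma KL_column_unique:
  assumes "KL_column v p" "KL_column v p'" "ble u v"
  shows "p u = p' u"
  using assms(3)
proof (induction "len v - len u" arbitrary: u rule: less_induct)
  case less
  show ?case
  proof (cases "u = v")
    case False
    let ?n = "len v - len u"
    have d: "2 * Polynomial.degree (p u) < ?n" "2 * Polynomial.degree (p' u) < ?n"
      using assms(1,2) less.prems False by (auto simp: KL_column_def)
    have split: "(\<Sum>a\<in>ints u v. R u a * r a) = r u + (\<Sum>a\<in>ints u v - {u}. R u a * r a)" for r
      using less.prems by (subst sum.remove[OF finite_ints, of u]) (auto simp: ints_def)
    have "p a = p' a" if "a \<in> ints u v - {u}" for a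
    proof -
      have "ble u a" "u \<noteq> a" "ble a v" using that by (auto simp: ints_def)
      then have "len u < len a" "len a \<le> len v" using ble_len_less ble_len_le by auto
      then show ?thesis using less.hyps[of a] \<open>ble a v\<close> by simp
    qed
    then have "(\<Sum>a\<in>ints u v - {u}. R u a * p a) = (\<Sum>a\<in>ints u v - {u}. R u a * p' a)"
      by simp
    then have "q_reverse ?n (p u) - p u = q_reverse ?n (p' u) - p' u"
      using assms(1,2) less.prems split[of p] split[of p'] unfolding KL_column_def by simp
    then have eq: "Polynomial.coeff (q_reverse ?n (p u)) i - Polynomial.coeff (p u) i =
        Polynomial.coeff (q_reverse ?n (p' u)) i - Polynomial.coeff (p' u) i" for i
      by (metis coeff_diff)
    show ?thesis
    proof (rule poly_eqI)
      fix i
      show "Polynomial.coeff (p u) i = Polynomial.coeff (p' u) i"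
      proof (cases "2 * i < ?n")
        case True
        then show ?thesis using eq[of i] d by (simp add: coeff_q_reverse coeff_eq_0)
      next
        case False
        then show ?thesis using d by (simp add: coeff_eq_0)
      qed
    qed
  qed (use assms in \<open>simp add: KL_column_def\<close>)
qed

text \<open>Let F be the sum and n the length difference. The reversal of P minus P has to be F, so
  P is minus the part of F in degrees i with 2i < n, that is, i < (n + 1) div 2.\<close>

function KL_poly :: "alcove \<Rightarrow> alcove \<Rightarrow> int poly" where
  "KL_poly v u =
    (if u = v then 1
     else if ble u v then - poly_cutoff ((len v - len u + 1) div 2) (\<Sum>a\<in>ints u v - {u}. R u a * KL_poly v a)
     else 0)"
  by auto
termination
proof (relation "measure (\<lambda>(v, u). len v - len u)", simp)
  fix u v a assume "a \<in> ints u v - {u}" "ble u v"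
  then have "len u < len a" "len a \<le> len v" using ble_len_less ints_len by (auto simp: ints_def)
  then show "((v, a), (v, u)) \<in> measure (\<lambda>(v, u). len v - len u)" by simp
qed

declare KL_poly.simps [simp del]

lemma KL_poly_degree:
  assumes "ble u v" "u \<noteq> v"
  shows "2 * Polynomial.degree (KL_poly v u) < len v - len u"
proof -
  let ?n = "len v - len u"
  have "?n > 0" using ble_len_less[OF assms] by simp
  moreover have "Polynomial.degree (KL_poly v u) \<le> (?n + 1) div 2 - 1"
    using assms by (intro degree_le) (auto simp: KL_poly.simps[of v u] coeff_poly_cutoff)
  ultimately show ?thesis by presburger
qed

lemma KL_poly_degree_le: "ble u v \<Longrightarrow> Polynomial.degree (KL_poly v u) \<le> len v - len u"
  using KL_poly_degree[of u v] by (cases "u = v") (auto simp: KL_poly.simps[of v v])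

text \<open>It has to be seen that F is antisymmetric under reversal. By induction the reversal of
  each \<open>KL_poly v a\<close> is a sum over \<open>b\<close>, and \<open>R_inverse\<close>
  collapses the resulting double sum.\<close>

lemma KL_poly_reverse:
  "ble u v \<Longrightarrow> q_reverse (len v - len u) (KL_poly v u) = (\<Sum>a\<in>ints u v. R u a * KL_poly v a)"
proof (induction "len v - len u" arbitrary: u rule: less_induct)
  case less
  show ?case
  proof (cases "u = v")
    case True
    have "ints v v = {v}" using ble_antisym by (auto simp: ints_def)
    then show ?thesis using True by (simp add: KL_poly.simps[of v v])
  next
    case False
    define n where "n = len v - len u"
    define A where "A = ints u v - {u}"
    define F where "F = (\<Sum>a\<in>A. R u a * KL_poly v a)"
    have uin: "u \<in> ints u v" using less.prems by (auto simp: ints_def)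
    have split: "(\<Sum>a\<in>ints u v. R u a * KL_poly v a) = KL_poly v u + F"
      unfolding F_def A_def using uin by (subst sum.remove[of _ u]) auto
    have A: "ble u a" "u \<noteq> a" "ble a v" "n = (len a - len u) + (len v - len a)"
        "len v - len a < len v - len u" "len u \<le> len a" if "a \<in> A" for a
      using that ble_len_less[of u a] ble_len_le[of a v] by (auto simp: A_def ints_def n_def)
    have dF: "Polynomial.degree (R u a * KL_poly v a) \<le> n" if "a \<in> A" for a
      using degree_mult_le[of "R u a" "KL_poly v a"] R_reverse[of u a] KL_poly_degree_le[OF A(3)[OF that]]
        A(4)[OF that] by linarith
    have "q_reverse n F = (\<Sum>a\<in>A. q_reverse n (R u a * KL_poly v a))"
      unfolding F_def by (rule q_reverse_sum) (rule dF)
    also have "\<dots> = (\<Sum>a\<in>A. \<Sum>b\<in>ints u v. (-1) ^ len u * ((-1) ^ len a * R u a * R a b) * KL_poly v b)"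
    proof (rule sum.cong[OF refl])
      fix a assume a: "a \<in> A"
      have "q_reverse n (R u a * KL_poly v a) =
          (-1) ^ (len a - len u) * R u a * (\<Sum>b\<in>ints a v. R a b * KL_poly v b)"
        unfolding A(4)[OF a] using R_reverse[of u a] KL_poly_degree_le[OF A(3)[OF a]]
          less.hyps[OF A(5)[OF a] A(3)[OF a]] by (simp add: q_reverse_mult)
      also have "(\<Sum>b\<in>ints a v. R a b * KL_poly v b) = (\<Sum>b\<in>ints u v. R a b * KL_poly v b)"
        using A(1)[OF a] R_support[of a] by (intro sum.mono_neutral_left finite_ints) (auto simp: ints_def)
      also have "(-1 :: int poly) ^ (len a - len u) = (-1) ^ len u * (-1) ^ len a"
      proof -
        have "(-1 :: int poly) ^ len a = (-1) ^ len u * (-1) ^ (len a - len u)"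
          using A(6)[OF a] by (metis le_add_diff_inverse power_add)
        then show ?thesis by (simp add: mult.assoc[symmetric] power_mult_distrib[symmetric])
      qed
      finally show "q_reverse n (R u a * KL_poly v a) =
          (\<Sum>b\<in>ints u v. (-1) ^ len u * ((-1) ^ len a * R u a * R a b) * KL_poly v b)"
        by (simp add: sum_distrib_left mult_ac)
    qed
    also have "\<dots> = (\<Sum>b\<in>ints u v. (-1) ^ len u * (\<Sum>a\<in>A. (-1) ^ len a * R u a * R a b) * KL_poly v b)"
      by (subst sum.swap) (simp add: sum_distrib_left sum_distrib_right)
    also have "\<dots> = (\<Sum>b\<in>ints u v. (of_bool (u = b) - R u b) * KL_poly v b)"
    proof (intro sum.cong refl arg_cong2[of _ _ _ _ "(*)"])
      fix b assume b: "b \<in> ints u v"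
      have "(\<Sum>a\<in>A. (-1) ^ len a * R u a * R a b) =
          (\<Sum>a\<in>{a. ble a b} - {u}. (-1) ^ len a * R u a * R a b)"
        using R_support b rtranclp_trans[of arc _ b v]
        by (intro sum.mono_neutral_cong) (auto simp: A_def ints_def finite_ble)
      also have "\<dots> = (\<Sum>a\<in>{a. ble a b}. (-1) ^ len a * R u a * R a b) - (-1) ^ len u * R u b"
        using b by (subst sum.remove[of "{a. ble a b}" u]) (auto simp: ints_def finite_ble)
      finally show "(-1) ^ len u * (\<Sum>a\<in>A. (-1) ^ len a * R u a * R a b) = of_bool (u = b) - R u b"
        by (simp add: R_inverse right_diff_distrib mult.assoc[symmetric] power_mult_distrib[symmetric])
    qed
    also have "\<dots> = KL_poly v u - (KL_poly v u + F)"
      using uin unfolding split[symmetric] by (simp add: left_diff_distrib sum_subtractf)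
    finally have anti: "q_reverse n F = - F" by simp
    have degF: "Polynomial.degree F \<le> n"
      unfolding F_def by (rule degree_sum_le) (auto simp: dF A_def)
    have P: "KL_poly v u = - poly_cutoff ((n + 1) div 2) F"
      using False less.prems by (simp add: KL_poly.simps[of v u] F_def A_def n_def)
    \<comment> \<open>The cutoff drops the middle coefficient, at 2i = n, but antisymmetry over the
      integers makes it 0.\<close>
    have "q_reverse n (KL_poly v u) = KL_poly v u + F"
    proof (rule poly_eqI)
      fix i
      have c: "Polynomial.coeff (q_reverse n F) i = - Polynomial.coeff F i"
        by (simp add: anti)
      show "Polynomial.coeff (q_reverse n (KL_poly v u)) i = Polynomial.coeff (KL_poly v u + F) i"
        using c KL_poly_degree_le[OF less.prems, folded n_def]
        by (cases "i \<le> n"; cases "2 * i = n")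
          (auto simp: coeff_q_reverse degF P coeff_poly_cutoff coeff_eq_0)
    qed
    then show ?thesis unfolding split n_def .
  qed
qed

lemma KL_column_KL_poly: "KL_column v (KL_poly v)"
  unfolding KL_column_def using KL_poly_reverse KL_poly_degree by (simp add: KL_poly.simps[of v v])

lemma pderiv_sum: "pderiv (sum f A) = (\<Sum>a\<in>A. pderiv (f a))"
  by (induction A rule: infinite_finite_induct) (simp_all add: pderiv_add)

text \<open>Differentiate the defining identity at \<open>q = 1\<close>.\<close>

lemma card_arcs:
  assumes one: "\<And>x. ble x v \<Longrightarrow> KL_poly v x = 1" and "ble u v"
  shows "card {a. arc u a \<and> ble a v} = len v - len u"
proof -
  let ?n = "len v - len u"
  have "Polynomial.monom 1 ?n = (\<Sum>a\<in>ints u v. R u a)"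
    using KL_poly_reverse[OF assms(2)] one assms(2) by (simp add: q_reverse_def ints_def)
  then have "poly (pderiv (Polynomial.monom 1 ?n)) 1 = poly (pderiv (\<Sum>a\<in>ints u v. R u a)) 1"
    by simp
  then have "int ?n = (\<Sum>a\<in>ints u v. of_bool (arc u a))"
    by (simp add: pderiv_monom pderiv_sum poly_sum poly_pderiv_R_1 poly_monom)
  also have "\<dots> = int (card {a \<in> ints u v. arc u a})"
    by (simp add: sum.If_cases of_bool_def Int_def)
  also have "{a \<in> ints u v. arc u a} = {a. arc u a \<and> ble a v}"
    by (auto simp: ints_def)
  finally show ?thesis by simp
qed

section \<open>The group of type \<open>A\<^sub>2~\<close>\<close>

text \<open>The labelling \<open>s\<close> is a parameter so that a diagram automorphism is just a
  second interpretation of the locale, with the same \<open>W\<close> and \<open>S\<close>.\<close>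

locale A2_tilde =
  fixes W :: "('a, 'b) monoid_scheme" (structure) and S :: "'a set" and s :: "node \<Rightarrow> 'a"
  assumes cox: "coxeter_system W S" and type: "type_A2_tilde W S" and s: "bij_betw s UNIV S"
begin

sublocale group W
  using cox by (simp add: coxeter_system_def)

lemma s_in [simp]: "s i \<in> S"
  using s by (auto simp: bij_betw_def)

lemma S_carrier: "S \<subseteq> carrier W"
  using cox by (simp add: coxeter_system_def)

lemma s_closed [simp]: "s i \<in> carrier W"
  using S_carrier s_in by blast

lemma s_inj [simp]: "s i = s j \<longleftrightarrow> i = j"
  using s by (auto simp: bij_betw_def inj_def)

lemma S_cases: "x \<in> S \<Longrightarrow> \<exists>i. x = s i"
  using s by (auto simp: bij_betw_def)

lemma s_s [simp]: "s i \<otimes> s i = \<one>"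
proof -
  have "ord (s i) = 2" using cox by (simp add: coxeter_system_def)
  then have "s i [^] (2::nat) = \<one>" using pow_ord_eq_1[of "s i"] by simp
  then show ?thesis by (simp add: numeral_2_eq_2)
qed

lemma inv_s [simp]: "inv (s i) = s i"
  by (simp add: inv_equality)

lemma mult_s_s [simp]: "x \<in> carrier W \<Longrightarrow> x \<otimes> s i \<otimes> s i = x"
  by (simp add: m_assoc)

lemma ord_s: "i \<noteq> j \<Longrightarrow> ord (s i \<otimes> s j) = 3"
  using type by (simp add: type_A2_tilde_def)

lemma s_braid:
  assumes "i \<noteq> j"
  shows "s i \<otimes> s j \<otimes> s i = s j \<otimes> s i \<otimes> s j"
proof -
  have "(s i \<otimes> s j) [^] (3::nat) = \<one>"
    using pow_ord_eq_1[of "s i \<otimes> s j"] ord_s[OF assms] by simp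
  then have "s i \<otimes> s j \<otimes> s i \<otimes> (s j \<otimes> s i \<otimes> s j) = \<one>"
    by (simp add: numeral_3_eq_3 m_assoc)
  then have "s i \<otimes> s j \<otimes> s i = inv (s j \<otimes> s i \<otimes> s j)"
    by (metis inv_equality m_closed s_closed)
  then show ?thesis by (simp add: inv_mult_group m_assoc)
qed

lemma word_prod_Nil [simp]: "word_prod W [] = \<one>"
  and word_prod_Cons [simp]: "word_prod W (x # ws) = x \<otimes> word_prod W ws"
  by (simp_all add: word_prod_def)

lemma word_prod_closed [simp]: "ws \<in> lists S \<Longrightarrow> word_prod W ws \<in> carrier W"
  using S_carrier by (induction ws) auto

lemma word_prod_append:
  "us \<in> lists S \<Longrightarrow> vs \<in> lists S \<Longrightarrow> word_prod W (us @ vs) = word_prod W us \<otimes> word_prod W vs"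
  using S_carrier by (induction us) (auto simp: m_assoc subset_iff)

lemma rev_lists [simp]: "rev ws \<in> lists A \<longleftrightarrow> ws \<in> lists A"
  by (simp add: in_lists_conv_set)

lemma word_prod_rev: "ws \<in> lists S \<Longrightarrow> word_prod W (rev ws) = inv (word_prod W ws)"
proof (induction ws)
  case (Cons x ws)
  then obtain i where "x = s i" using S_cases by auto
  then show ?case using Cons by (simp add: word_prod_append inv_mult_group)
qed simp

lemma ex_word: "x \<in> carrier W \<Longrightarrow> \<exists>ws\<in>lists S. word_prod W ws = x"
proof -
  assume "x \<in> carrier W"
  then have "x \<in> generate W S" using cox by (simp add: coxeter_system_def)
  then show ?thesis
  proof (induction rule: generate.induct)
    case one
    show ?case by (rule bexI[of _ "[]"]) simp_all
  next
    case (incl h)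
    then show ?case using S_carrier by (intro bexI[of _ "[h]"]) auto
  next
    case (inv h)
    then obtain i where "h = s i" using S_cases by blast
    then show ?case by (intro bexI[of _ "[h]"]) auto
  next
    case (eng h1 h2)
    then obtain us vs where "us \<in> lists S" "vs \<in> lists S" "word_prod W us = h1" "word_prod W vs = h2"
      by blast
    then show ?case by (intro bexI[of _ "us @ vs"]) (auto simp: word_prod_append)
  qed
qed

text \<open>
  Right multiplication by \<open>s i\<close> becomes the reflection \<open>simple i\<close>: the alcove \<open>alc w\<close> below is the
  image of the base alcove under \<open>w\<inverse>\<close>.
\<close>

definition act :: "'a list \<Rightarrow> alcove \<Rightarrow> alcove" where
  "act ws a = foldl (\<lambda>a x. simple (the_inv s x) a) a ws"

lemma the_inv_s [simp]: "the_inv s (s i) = i"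
  using s by (auto simp: bij_betw_def intro: the_inv_f_f)

lemma act_Nil [simp]: "act [] a = a"
  and act_Cons [simp]: "act (x # ws) a = act ws (simple (the_inv s x) a)"
  and act_append: "act (us @ vs) a = act vs (act us a)"
  by (simp_all add: act_def)

lemma act_step: "coxeter_step W S us vs \<Longrightarrow> act us = act vs"
proof (induction rule: coxeter_step.induct)
  case (1 x y us vs)
  then obtain i j where ij: "x = s i" "y = s j" using S_cases by blast
  have "act (concat (replicate (ord (x \<otimes> y)) [x, y])) a = a" for a
  proof (cases "i = j")
    case True
    then show ?thesis by (simp add: ij ord_id)
  next
    case False
    have "simple j (simple i (simple j (simple i (simple j (simple i a))))) = a"
      using simple_braid[OF False, of "simple j (simple i a)"] by simp
    then show ?thesis using False by (simp add: ij ord_s numeral_3_eq_3)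
  qed
  then show ?case by (auto simp: act_append)
qed

text \<open>Here the presentation enters: relation steps do not change the action, and they connect
  any word for the identity with the empty word. Hence \<open>alc\<close> does not depend on the
  word chosen.\<close>

lemma act_one:
  assumes "ws \<in> lists S" "word_prod W ws = \<one>"
  shows "act ws a = a"
proof -
  have "equivclp (coxeter_step W S) ws []" using assms cox by (simp add: coxeter_system_def)
  then have "act ws = act []"
    by (induction rule: equivclp_induct) (auto dest: act_step)
  then show ?thesis by simp
qed

lemma act_rev: "act ws (act (rev ws) a) = a"
  by (induction ws arbitrary: a) (simp_all add: act_append)

lemma act_cong:
  assumes "us \<in> lists S" "vs \<in> lists S" "word_prod W us = word_prod W vs"
  shows "act us a = act vs a"
proof -
  have "act (us @ rev vs) a = a"
    using assms by (intro act_one) (simp_all add: word_prod_append word_prod_rev)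
  then have "act vs (act (rev vs) (act us a)) = act vs a" by (simp add: act_append)
  then show ?thesis by (simp add: act_rev)
qed

definition alc :: "'a \<Rightarrow> alcove" where
  "alc x = act (SOME ws. ws \<in> lists S \<and> word_prod W ws = x) base_alcove"

lemma alc_word_prod:
  assumes "ws \<in> lists S"
  shows "alc (word_prod W ws) = act ws base_alcove"
proof -
  have "\<exists>us. us \<in> lists S \<and> word_prod W us = word_prod W ws" using assms by blast
  from someI_ex[OF this] show ?thesis
    unfolding alc_def using assms by (intro act_cong) auto
qed

lemma alc_one [simp]: "alc \<one> = base_alcove"
  using alc_word_prod[of "[]"] by simp

lemma alc_mult_s [simp]:
  assumes "x \<in> carrier W"
  shows "alc (x \<otimes> s i) = simple i (alc x)"
proof -
  obtain ws where ws: "ws \<in> lists S" "word_prod W ws = x" using ex_word[OF assms] by blast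
  then have "word_prod W (ws @ [s i]) = x \<otimes> s i" by (simp add: word_prod_append)
  then show ?thesis
    using alc_word_prod[of "ws @ [s i]"] alc_word_prod[OF ws(1)] ws by (simp add: act_append)
qed

text \<open>The inverse of \<open>alc\<close>. Its consistency uses only that the braid relations
  hold in the group.\<close>

definition elt :: "alcove \<Rightarrow> 'a" where
  "elt = matsumoto (\<lambda>i x. x \<otimes> s i) \<one>"

lemma elt_closed [simp]: "elt a \<in> carrier W"
  unfolding elt_def by (rule matsumoto_in) auto

lemma elt_base [simp]: "elt base_alcove = \<one>"
  by (simp add: elt_def matsumoto_base)

lemma elt_simple: "elt (simple i a) = elt a \<otimes> s i"
proof -
  have *: "elt b = elt (simple i b) \<otimes> s i" if "coord i b < 0" for b
    unfolding elt_def using that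
    by (intro matsumoto_descent[where X = "carrier W"]) (auto simp: m_assoc s_braid[unfolded m_assoc[OF s_closed s_closed s_closed]])
  show ?thesis
  proof (cases "coord i a < 0")
    case True
    then show ?thesis using *[of a] by (metis elt_closed mult_s_s)
  next
    case False
    then show ?thesis using *[of "simple i a"] by (simp add: coord_mirror)
  qed
qed

lemma elt_act: "ws \<in> lists S \<Longrightarrow> elt (act ws a) = elt a \<otimes> word_prod W ws"
proof (induction ws arbitrary: a)
  case (Cons x ws)
  then obtain i where "x = s i" using S_cases by auto
  then show ?case using Cons by (simp add: elt_simple m_assoc)
qed simp

lemma elt_alc [simp]: "x \<in> carrier W \<Longrightarrow> elt (alc x) = x"
  using ex_word[of x] alc_word_prod elt_act[of _ base_alcove] by force

lemma alc_elt [simp]: "alc (elt a) = a"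
proof (induction a rule: alcove_induct)
  case (step v i)
  have "alc (elt (simple i v) \<otimes> s i) = v" using step(2) by simp
  then show ?case by (simp add: elt_simple[symmetric])
qed simp

lemma alc_inj: "x \<in> carrier W \<Longrightarrow> y \<in> carrier W \<Longrightarrow> alc x = alc y \<longleftrightarrow> x = y"
  by (metis elt_alc)

lemma word_length_alc:
  assumes "x \<in> carrier W"
  shows "word_length W S x = len (alc x)"
  unfolding word_length_def
proof (rule Least_equality)
  have "\<exists>ws\<in>lists S. length ws = len a \<and> word_prod W ws = elt a" for a
  proof (induction a rule: alcove_induct)
    case base
    show ?case by (rule bexI[of _ "[]"]) simp_all
  next
    case (step v i)
    then obtain ws where ws: "ws \<in> lists S" "length ws = len (simple i v)" "word_prod W ws = elt (simple i v)"
      by blast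
    have "len v = Suc (len (simple i v))" using step(1) len_simple[of i v] len_pos[OF step(1)] by simp
    moreover have "elt (simple i v) \<otimes> s i = elt v" by (simp add: elt_simple[symmetric])
    ultimately show ?case using ws by (intro bexI[of _ "ws @ [s i]"]) (auto simp: word_prod_append)
  qed
  from this[of "alc x"] show "\<exists>ws\<in>lists S. length ws = len (alc x) \<and> word_prod W ws = x"
    using assms by simp
next
  fix n assume "\<exists>ws\<in>lists S. length ws = n \<and> word_prod W ws = x"
  then obtain ws where ws: "ws \<in> lists S" "length ws = n" "word_prod W ws = x" by blast
  have "len (act ws a) \<le> len a + length ws" for a
  proof (induction ws arbitrary: a)
    case (Cons y ws)
    have "len (act (y # ws) a) \<le> len (simple (the_inv s y) a) + length ws" using Cons by simp
    then show ?case by (simp add: len_simple split: if_splits)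
  qed simp
  from this[of base_alcove] show "len (alc x) \<le> n"
    using alc_word_prod[OF ws(1)] ws by simp
qed

section \<open>Reflections, Bruhat graph and Bruhat order of the group in terms of alcoves\<close>

lemma reflections_closed: "t \<in> reflections W S \<Longrightarrow> t \<in> carrier W"
  using S_carrier by (auto simp: reflections_def)

lemma reflectionsI: "x \<in> carrier W \<Longrightarrow> r \<in> S \<Longrightarrow> x \<otimes> r \<otimes> inv x \<in> reflections W S"
  by (auto simp: reflections_def)

lemma reflections_conj:
  assumes "t \<in> reflections W S"
  shows "s j \<otimes> t \<otimes> s j \<in> reflections W S"
proof -
  obtain x r where t: "t = x \<otimes> r \<otimes> inv x" "x \<in> carrier W" "r \<in> S"
    using assms by (auto simp: reflections_def)
  then have "s j \<otimes> t \<otimes> s j = (s j \<otimes> x) \<otimes> r \<otimes> inv (s j \<otimes> x)"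
    using S_carrier by (auto simp: inv_mult_group m_assoc subset_iff)
  then show ?thesis using reflectionsI[of "s j \<otimes> x" r] t by simp
qed

lemma alc_conj:
  assumes "t \<in> carrier W" "\<And>x. x \<in> carrier W \<Longrightarrow> alc (x \<otimes> t) = mirror k n (alc x)" "x \<in> carrier W"
  shows "alc (x \<otimes> (s j \<otimes> t \<otimes> s j)) =
    (if j = k then mirror k (- n) (alc x) else mirror (third j k) (1 - n) (alc x))"
proof -
  have "alc (x \<otimes> (s j \<otimes> t \<otimes> s j)) = alc (((x \<otimes> s j) \<otimes> t) \<otimes> s j)"
    using assms by (simp add: m_assoc)
  also have "\<dots> = simple j (mirror k n (simple j (alc x)))"
    using assms by simp
  finally show ?thesis by (simp add: simple_mirror)
qed

lemma reflection_mirror: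
  assumes "t \<in> reflections W S"
  shows "\<exists>k n. \<forall>x\<in>carrier W. alc (x \<otimes> t) = mirror k n (alc x)"
proof -
  obtain g r where gr: "t = g \<otimes> r \<otimes> inv g" "g \<in> carrier W" "r \<in> S"
    using assms by (auto simp: reflections_def)
  then obtain i where t: "t = g \<otimes> s i \<otimes> inv g" "g \<in> carrier W" using S_cases by blast
  obtain ws where ws: "ws \<in> lists S" "word_prod W ws = g" using ex_word[OF t(2)] by blast
  have "\<exists>k n. \<forall>x\<in>carrier W. alc (x \<otimes> (word_prod W ws \<otimes> s i \<otimes> inv (word_prod W ws))) = mirror k n (alc x)"
    using ws(1)
  proof (induction ws)
    case Nil
    show ?case by (intro exI[of _ i] exI[of _ 0]) simp
  next
    case (Cons y ws)
    then obtain j where j: "y = s j" using S_cases by auto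
    define r where "r = word_prod W ws \<otimes> s i \<otimes> inv (word_prod W ws)"
    have r: "r \<in> carrier W" using Cons.hyps by (simp add: r_def)
    obtain k n where kn: "\<And>x. x \<in> carrier W \<Longrightarrow> alc (x \<otimes> r) = mirror k n (alc x)"
      using Cons unfolding r_def by blast
    have "word_prod W (y # ws) \<otimes> s i \<otimes> inv (word_prod W (y # ws)) = s j \<otimes> r \<otimes> s j"
      using Cons.hyps by (simp add: j r_def inv_mult_group m_assoc)
    then show ?case using alc_conj[OF r kn, of _ j] by (cases "j = k") auto
  qed
  then show ?thesis using ws t by simp
qed

text \<open>Conjugation by \<open>s k\<close> changes n into -n, and conjugation by another
  generator changes n into 1 - n and the index into the third one. Together they lead from n to n +
  1; since the index moves, \<open>P\<close> quantifies over all \<open>k\<close>.\<close>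

lemma mirror_reflection:
  "\<exists>t\<in>reflections W S. \<forall>x\<in>carrier W. alc (x \<otimes> t) = mirror k n (alc x)"
proof -
  define P where "P n \<longleftrightarrow> (\<forall>k. \<exists>t\<in>reflections W S. \<forall>x\<in>carrier W. alc (x \<otimes> t) = mirror k n (alc x))" for n
  have P0: "P 0"
    unfolding P_def
  proof
    fix k
    have "s k \<in> reflections W S" using reflectionsI[of \<one> "s k"] by simp
    then show "\<exists>t\<in>reflections W S. \<forall>x\<in>carrier W. alc (x \<otimes> t) = simple k (alc x)"
      by (intro bexI[of _ "s k"]) simp_all
  qed
  have Pneg: "P (- n)" if Pn: "P n" for n
    unfolding P_def
  proof
    fix k
    obtain t where t: "t \<in> reflections W S" "\<forall>x\<in>carrier W. alc (x \<otimes> t) = mirror k n (alc x)"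
      using Pn unfolding P_def by blast
    show "\<exists>t\<in>reflections W S. \<forall>x\<in>carrier W. alc (x \<otimes> t) = mirror k (- n) (alc x)"
      using reflections_conj[OF t(1), of k] alc_conj[OF reflections_closed[OF t(1)] t(2)[rule_format], of _ k] by auto
  qed
  have Pone: "P (1 - n)" if Pn: "P n" for n
    unfolding P_def
  proof
    fix k
    obtain j where j: "third j (third j k) = k" "j \<noteq> third j k"
      by (cases k) (metis third.simps node.distinct)+
    obtain t where t: "t \<in> reflections W S" "\<forall>x\<in>carrier W. alc (x \<otimes> t) = mirror (third j k) n (alc x)"
      using Pn unfolding P_def by blast
    show "\<exists>t\<in>reflections W S. \<forall>x\<in>carrier W. alc (x \<otimes> t) = mirror k (1 - n) (alc x)"
      using reflections_conj[OF t(1), of j] alc_conj[OF reflections_closed[OF t(1)] t(2)[rule_format], of _ j] j by auto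
  qed
  have Pnat: "P (int m)" for m
  proof (induction m)
    case (Suc m)
    then show ?case using Pone[OF Pneg[of "int m"]] by (simp add: algebra_simps)
  qed (simp add: P0)
  have "P n"
    using Pnat[of "nat n"] Pneg[OF Pnat[of "nat (- n)"]] by (cases "n \<ge> 0") auto
  then show ?thesis unfolding P_def by blast
qed

lemma verts_bruhat: "verts (bruhat_graph W S) = carrier W"
  by (simp add: bruhat_graph_def)

lemma arcs_bruhat:
  "arcs (bruhat_graph W S) = {(x, y). x \<in> carrier W \<and> y \<in> carrier W \<and> arc (alc x) (alc y)}"
proof -
  have "(\<exists>t. y = x \<otimes> t \<and> t \<in> reflections W S \<and> word_length W S x < word_length W S (x \<otimes> t)) \<longleftrightarrow>
      y \<in> carrier W \<and> arc (alc x) (alc y)" (is "?l \<longleftrightarrow> ?r") if x: "x \<in> carrier W" for x y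
  proof
    assume ?l
    then obtain t where t: "y = x \<otimes> t" "t \<in> reflections W S" "word_length W S x < word_length W S (x \<otimes> t)"
      by blast
    then have y: "y \<in> carrier W" using x reflections_closed by simp
    moreover have "len (alc x) < len (alc y)" using t x y by (simp add: word_length_alc)
    ultimately show ?r using reflection_mirror[OF t(2)] t(1) x by (auto simp: arc_def)
  next
    assume r: ?r
    then obtain k n where kn: "alc y = mirror k n (alc x)" by (auto simp: arc_def)
    obtain t where t: "t \<in> reflections W S" "\<forall>x\<in>carrier W. alc (x \<otimes> t) = mirror k n (alc x)"
      using mirror_reflection by blast
    then have tc: "x \<otimes> t \<in> carrier W" using x reflections_closed by simp
    then have "y = x \<otimes> t" using alc_inj[of y "x \<otimes> t"] r t x kn by simp
    then show ?l using t r x tc by (intro exI[of _ t]) (auto simp: word_length_alc dest: arc_len)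
  qed
  then show ?thesis by (auto simp: bruhat_graph_def)
qed

lemma arcs_ends_bruhat: "arcs_ends (bruhat_graph W S) = arcs (bruhat_graph W S)"
  by (auto simp: bruhat_graph_def arcs_ends_def arc_to_ends_def)

lemma bruhat_le_iff: "bruhat_le W S x y \<longleftrightarrow> x \<in> carrier W \<and> y \<in> carrier W \<and> ble (alc x) (alc y)"
proof
  assume "bruhat_le W S x y"
  then have *: "(x, y) \<in> rtrancl_on (carrier W) (arcs (bruhat_graph W S))"
    by (simp add: bruhat_le_def reachable_def verts_bruhat arcs_ends_bruhat)
  then have "ble (alc x) (alc y)"
    by (induction rule: rtrancl_on_induct) (auto simp: arcs_bruhat intro: rtranclp.rtrancl_into_rtrancl)
  then show "x \<in> carrier W \<and> y \<in> carrier W \<and> ble (alc x) (alc y)"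
    using in_rtrancl_on_in_F[OF *] by simp
next
  assume r: "x \<in> carrier W \<and> y \<in> carrier W \<and> ble (alc x) (alc y)"
  have "(elt a, elt b) \<in> rtrancl_on (carrier W) (arcs (bruhat_graph W S))" if "ble a b" for a b
    using that
  proof (induction rule: rtranclp_induct)
    case (step b c)
    then show ?case by (intro rtrancl_on_into_rtrancl_on[OF step(3)]) (auto simp: arcs_bruhat)
  qed simp
  from this[of "alc x" "alc y"] r show "bruhat_le W S x y"
    by (simp add: bruhat_le_def reachable_def verts_bruhat arcs_ends_bruhat)
qed

lemma bruhat_interval_eq:
  assumes "x \<in> carrier W" "y \<in> carrier W"
  shows "bruhat_interval W S x y = elt ` ints (alc x) (alc y)"
proof -
  have "z \<in> elt ` ints (alc x) (alc y)" if "z \<in> carrier W" "alc z \<in> ints (alc x) (alc y)" for z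
    using that by (metis elt_alc image_eqI)
  then show ?thesis using assms by (auto simp: bruhat_interval_def bruhat_le_iff ints_def)
qed

lemma inj_elt: "inj_on elt A"
  by (rule inj_on_inverseI[of _ alc]) simp

section \<open>Evaluation of the two definite descriptions\<close>

definition R_W :: "'a \<Rightarrow> 'a \<Rightarrow> int poly" where
  "R_W u v = (if u \<in> carrier W \<and> v \<in> carrier W then R (alc u) (alc v) else 0)"

lemma R_family: "is_R_family W S R_W"
  unfolding is_R_family_def
proof (intro conjI allI ballI impI)
  fix u v assume "\<not> bruhat_le W S u v"
  then show "R_W u v = 0" using R_support by (auto simp: R_W_def bruhat_le_iff)
next
  fix u assume "u \<in> carrier W"
  then show "R_W u u = 1" by (simp add: R_W_def)
next
  fix u v r assume *: "u \<in> carrier W" "v \<in> carrier W" "r \<in> S"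
    "word_length W S (v \<otimes> r) < word_length W S v"
  obtain i where "r = s i" using *(3) S_cases by blast
  then show "R_W u v = (if word_length W S (u \<otimes> r) < word_length W S u then R_W (u \<otimes> r) (v \<otimes> r)
      else [:0, 1:] * R_W (u \<otimes> r) (v \<otimes> r) + ([:0, 1:] - 1) * R_W u (v \<otimes> r))"
    using * R_rec[of i "alc v" "alc u"] by (simp add: R_W_def word_length_alc descent_iff)
qed

text \<open>The description asks for equality on the whole type. Off the carrier
  \<open>bruhat_le\<close> fails, which forces the value 0 there; on the carrier the recursion
  determines everything.\<close>

lemma R_family_unique:
  assumes "is_R_family W S R'"
  shows "R' = R_W"
proof -
  have out: "R' u v = 0" if "\<not> (u \<in> carrier W \<and> v \<in> carrier W)" for u v
    using assms that bruhat_le_iff[of u v] by (auto simp: is_R_family_def)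
  have R: "R' (elt a) (elt b) = R a b" for a b
  proof (induction b arbitrary: a rule: alcove_induct)
    case base
    have 1: "R' \<one> \<one> = 1" using assms by (simp add: is_R_family_def)
    have 2: "R' (elt a) \<one> = 0" if "a \<noteq> base_alcove"
      using assms that ble_base_iff[of a] bruhat_le_iff[of "elt a" \<one>] by (auto simp: is_R_family_def)
    show ?case using 1 2 by (cases "a = base_alcove") (auto simp: R_base)
  next
    case (step v i)
    have "word_length W S (elt v \<otimes> s i) < word_length W S (elt v)"
      using step(1) by (simp add: word_length_alc descent_iff)
    then have "R' (elt a) (elt v) = (if word_length W S (elt a \<otimes> s i) < word_length W S (elt a)
        then R' (elt a \<otimes> s i) (elt v \<otimes> s i)
        else [:0, 1:] * R' (elt a \<otimes> s i) (elt v \<otimes> s i) + ([:0, 1:] - 1) * R' (elt a) (elt v \<otimes> s i))"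
      using assms unfolding is_R_family_def by (meson elt_closed s_in)
    also have "word_length W S (elt a \<otimes> s i) < word_length W S (elt a) \<longleftrightarrow> coord i a < 0"
      by (simp add: word_length_alc descent_iff)
    finally show ?case using R_rec[OF step(1), of a] step(2) by (simp add: elt_simple[symmetric])
  qed
  have "R' u v = R_W u v" for u v
    using out[of u v] R[of "alc u" "alc v"]
    by (cases "u \<in> carrier W \<and> v \<in> carrier W") (auto simp: R_W_def)
  then show ?thesis by blast
qed

lemma R_polynomial_eq: "R_polynomial W S = R_W"
  unfolding R_polynomial_def using R_family R_family_unique by (rule the_equality)

definition KL_W :: "'a \<Rightarrow> 'a \<Rightarrow> int poly" where
  "KL_W u v = (if u \<in> carrier W \<and> v \<in> carrier W then KL_poly (alc v) (alc u) else 0)"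

lemma sum_interval:
  assumes "u \<in> carrier W" "v \<in> carrier W"
  shows "(\<Sum>a\<in>bruhat_interval W S u v. R_polynomial W S u a * P a v) =
    (\<Sum>a\<in>ints (alc u) (alc v). R (alc u) a * P (elt a) v)"
  using assms by (simp add: bruhat_interval_eq sum.reindex[OF inj_elt] R_polynomial_eq R_W_def)

lemma KL_family: "is_KL_family W S KL_W"
  unfolding is_KL_family_def
proof (intro conjI allI impI ballI)
  fix u v assume "\<not> bruhat_le W S u v"
  then show "KL_W u v = 0"
    by (auto simp: KL_W_def bruhat_le_iff KL_poly.simps[of "alc v"] alc_inj)
next
  fix u assume "u \<in> carrier W"
  then show "KL_W u u = 1" by (simp add: KL_W_def KL_poly.simps)
next
  fix u v assume *: "bruhat_le W S u v \<and> u \<noteq> v"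
  then have "alc u \<noteq> alc v" using alc_inj by (auto simp: bruhat_le_iff)
  then show "2 * int (Polynomial.degree (KL_W u v)) \<le> int (word_length W S v) - int (word_length W S u) - 1"
    using * KL_poly_degree[of "alc u" "alc v"] by (simp add: KL_W_def bruhat_le_iff word_length_alc)
next
  fix u v assume *: "bruhat_le W S u v"
  then show "q_reverse (word_length W S v - word_length W S u) (KL_W u v) =
      (\<Sum>a\<in>bruhat_interval W S u v. R_polynomial W S u a * KL_W a v)"
    using KL_poly_reverse[of "alc u" "alc v"] sum_interval[of u v KL_W]
    by (simp add: KL_W_def bruhat_le_iff word_length_alc)
qed

lemma KL_family_unique:
  assumes "is_KL_family W S P"
  shows "P = KL_W"
proof -
  have out: "P u v = 0" if "\<not> bruhat_le W S u v" for u v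
    using assms that by (auto simp: is_KL_family_def)
  have "P u v = KL_W u v" if le: "bruhat_le W S u v" for u v
  proof -
    have c: "u \<in> carrier W" "v \<in> carrier W" "ble (alc u) (alc v)" using le by (auto simp: bruhat_le_iff)
    have "KL_column (alc v) (\<lambda>a. P (elt a) v)"
      unfolding KL_column_def
    proof (intro conjI allI impI)
      show "P (elt (alc v)) v = 1" using assms c by (simp add: is_KL_family_def)
    next
      fix a assume a: "ble a (alc v) \<and> a \<noteq> alc v"
      then have "bruhat_le W S (elt a) v" "elt a \<noteq> v" using c by (auto simp: bruhat_le_iff)
      then have "2 * int (Polynomial.degree (P (elt a) v)) \<le> int (word_length W S v) - int (word_length W S (elt a)) - 1"
        using assms by (simp add: is_KL_family_def)
      then show "2 * Polynomial.degree (P (elt a) v) < len (alc v) - len a"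
        using c by (simp add: word_length_alc)
    next
      fix a assume a: "ble a (alc v)"
      then have le: "bruhat_le W S (elt a) v" using c by (auto simp: bruhat_le_iff)
      then have "q_reverse (word_length W S v - word_length W S (elt a)) (P (elt a) v) =
          (\<Sum>b\<in>bruhat_interval W S (elt a) v. R_polynomial W S (elt a) b * P b v)"
        using assms by (simp add: is_KL_family_def)
      then show "q_reverse (len (alc v) - len a) (P (elt a) v) = (\<Sum>b\<in>ints a (alc v). R a b * P (elt b) v)"
        using c sum_interval[of "elt a" v] by (simp add: word_length_alc)
    qed
    from KL_column_unique[OF this KL_column_KL_poly c(3)] show ?thesis
      using c by (simp add: KL_W_def)
  qed
  moreover have "P u v = KL_W u v" if "\<not> bruhat_le W S u v" for u v
    using that out KL_family by (auto simp: is_KL_family_def)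
  ultimately have "P u v = KL_W u v" for u v by blast
  then show ?thesis by blast
qed

lemma KL_polynomial_eq: "KL_polynomial W S = KL_W"
  unfolding KL_polynomial_def using KL_family KL_family_unique by (rule the_equality)

lemma rationally_smooth_iff:
  assumes "y \<in> carrier W"
  shows "(\<forall>x. bruhat_le W S x y \<longrightarrow> KL_polynomial W S x y = 1) \<longleftrightarrow>
    (\<forall>a. ble a (alc y) \<longrightarrow> KL_poly (alc y) a = 1)"
proof
  assume l: "\<forall>x. bruhat_le W S x y \<longrightarrow> KL_polynomial W S x y = 1"
  show "\<forall>a. ble a (alc y) \<longrightarrow> KL_poly (alc y) a = 1"
  proof (intro allI impI)
    fix a assume "ble a (alc y)"
    then show "KL_poly (alc y) a = 1"
      using l[rule_format, of "elt a"] assms by (simp add: bruhat_le_iff KL_polynomial_eq KL_W_def)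
  qed
qed (auto simp: bruhat_le_iff KL_polynomial_eq KL_W_def)

end

section \<open>Alcoves with too many Bruhat arcs\<close>

definition ups :: "node \<Rightarrow> int \<Rightarrow> alcove \<Rightarrow> bool" where
  "ups i n a \<longleftrightarrow> (if n \<ge> 1 then coord i a < n else coord i a \<ge> n)"

fun walk :: "(node \<times> int) list \<Rightarrow> alcove \<Rightarrow> alcove" where
  "walk [] a = a"
| "walk ((i, n) # ps) a = walk ps (mirror i n a)"

fun down_walk :: "(node \<times> int) list \<Rightarrow> alcove \<Rightarrow> bool" where
  "down_walk [] a \<longleftrightarrow> True"
| "down_walk ((i, n) # ps) a \<longleftrightarrow> \<not> ups i n a \<and> down_walk ps (mirror i n a)"

lemma arc_mirror: "arc a (mirror i n a) \<longleftrightarrow> ups i n a"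
  by (auto simp: arc_def ups_def len_mirror)

lemma arc_mirror_down: "arc (mirror i n a) a \<longleftrightarrow> \<not> ups i n a"
  using arc_mirror[of "mirror i n a" i n] by (auto simp: ups_def coord_mirror)

lemma ble_walk: "down_walk ps a \<Longrightarrow> ble (walk ps a) a"
  by (induction ps a rule: walk.induct) (auto simp: arc_mirror_down[symmetric] intro: rtranclp.rtrancl_into_rtrancl)

text \<open>An entry \<open>(t, ps)\<close> of \<open>qs\<close> certifies one arc from
  \<open>u\<close> that stays below \<open>y\<close>: \<open>t\<close> is its mirror, and
  \<open>ps\<close> lists the mirrors of a descending path from \<open>y\<close> to its end. By
  \<open>mirror_inj\<close> distinct mirrors have distinct ends, so a list longer than the length
  difference is impossible.\<close>

lemma too_many_arcs:
  assumes card: "\<And>u. ble u y \<Longrightarrow> card {a. arc u a \<and> ble a y} = len y - len u"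
    and qs: "qs \<noteq> []" "distinct (map fst qs)"
      "\<forall>(t, ps)\<in>set qs. ups (fst t) (snd t) u \<and> down_walk ps y \<and> walk ps y = mirror (fst t) (snd t) u"
  shows "int (length qs) + int (len u) \<le> int (len y)"
proof -
  let ?f = "\<lambda>(i, n). mirror i n u"
  have *: "arc u (?f t) \<and> ble (?f t) y" if t: "t \<in> set (map fst qs)" for t
  proof -
    obtain ps where "(t, ps) \<in> set qs" using t by force
    then have "ups (fst t) (snd t) u" "down_walk ps y" "walk ps y = mirror (fst t) (snd t) u"
      using qs(3) by auto
    then show ?thesis using ble_walk[of ps y] by (cases t) (simp add: arc_mirror)
  qed
  have "fst (hd qs) \<in> set (map fst qs)" using qs(1) by simp
  then obtain t where "t \<in> set (map fst qs)" by blast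
  then have u: "ble u y" using *[of t] by (meson converse_rtranclp_into_rtranclp)
  have inj: "inj_on ?f (set (map fst qs))" by (rule inj_onI) (auto simp: mirror_inj)
  have "length qs = card (?f ` set (map fst qs))"
    using card_image[OF inj] distinct_card[OF qs(2)] by simp
  also have "\<dots> \<le> card {a. arc u a \<and> ble a y}"
    using * by (intro card_mono rev_finite_subset[OF finite_ble[of y]]) auto
  finally show ?thesis using card[OF u] ble_len_le[OF u] by simp
qed

definition smooth_alcoves :: "alcove set" where
  "smooth_alcoves = {Alcove 0 0 False, Alcove (- 1) 0 True, Alcove (- 1) 0 False, Alcove (- 2) 0 True,
    Alcove (- 2) 1 False, Alcove (- 1) (- 1) False} \<union> {Alcove (- k) (- 1) True | k. k \<ge> 1}"

lemma smooth_classification: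
  assumes card: "\<And>u. ble u y \<Longrightarrow> card {a. arc u a \<and> ble a y} = len y - len u"
    and sorted: "coord N0 y \<le> coord N1 y" "coord N1 y \<le> coord N2 y"
  shows "y \<in> smooth_alcoves"
proof -
  txt \<open>
    In every other case the list records more arcs out of some \<open>u\<close> below \<open>y\<close> than \<open>len y - len u\<close>,
    which is \<open>3\<close> or \<open>4\<close>: each arc comes with the mirrors of a descending path from \<open>y\<close> to its end.
  \<close>
  note many = too_many_arcs[OF card]
  note simps = ups_def int_len
  have F1: False if "y = Alcove (- m) 0 False" "m \<ge> 2" for m
    using many[of "[((N1, 0), [(N0, 0), (N0, 1)]), ((N1, 1), [(N2, m), (N2, m - 1)]),
        ((N2, m - 1), [(N2, m), (N0, 1 - m)]), ((N2, 0), [(N0, 0), (N1, 0)])]"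
        "Alcove (1 - m) 0 True"] that by (simp add: simps)
  have F2: False if "y = Alcove (- m - 1) 0 True" "m \<ge> 2" for m
    using many[of "[((N0, 1 - m), [(N2, m), (N1, 1)]), ((N1, 0), [(N0, 0), (N0, 1)]),
        ((N1, 1), [(N2, m), (N2, m - 1)]), ((N2, 0), [(N0, 0), (N1, 0)])]"
        "Alcove (1 - m) 0 False"] that by (simp add: simps)
  have F3: False if "y = Alcove (- p - q) p False" "p \<ge> 1" "q \<ge> p" "q \<ge> 2" for p q
    using many[of "[((N0, 1 - q), [(N1, 1), (N0, - q)]), ((N0, 1), [(N0, 0), (N2, 0)]),
        ((N1, 1), [(N2, q), (N2, q - 1)]), ((N2, 0), [(N0, 0), (N1, 0)])]"
        "Alcove (1 - q) (- p) True"] that by (simp add: simps)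
  have F4: False if "y = Alcove (- p - q - 1) p True" "p \<ge> 1" "q \<ge> p" "q \<ge> 2" for p q
    using many[of "[((N0, 1 - p - q), [(N2, q), (N1, p + 1)]), ((N1, p + 1), [(N2, q), (N2, q - 1)]),
        ((N2, 0), [(N1, p), (N2, 1)]), ((N2, q), [(N1, p), (N2, q + 1)])]"
        "Alcove (1 - p - q) p False"] that by (simp add: simps)
  \<comment> \<open>The case p = q = 1 left open by \<open>F4\<close> is refuted four levels below
    \<open>y\<close>, by six arcs.\<close>
  have F4': False if "y = Alcove (- 3) 1 True"
    using many[of "[((N0, - 1), [(N0, - 2)]), ((N0, 1), [(N0, 0)]), ((N1, 0), [(N0, 0), (N1, 0), (N2, 0)]),
        ((N1, 1), [(N0, - 2), (N1, 1), (N2, 1)]), ((N2, 0), [(N0, 0), (N1, 0), (N0, 1)]),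
        ((N2, 1), [(N0, - 2), (N1, 1), (N0, - 1)])]" "Alcove (- 1) 0 True"] that by (simp add: simps)
  have F5: False if "y = Alcove (- p) (- q) False" "q \<ge> 1" "p \<ge> q" "p \<ge> 2" for p q
    using many[of "[((N0, 1 - p), [(N1, 1 - q), (N0, - p)]), ((N0, 1), [(N0, 0), (N2, q)]),
        ((N1, - q), [(N0, 0), (N0, 1)]), ((N2, p + q - 1), [(N0, 1 - p), (N1, - q)])]"
        "Alcove (1 - p) (- q) True"] that by (simp add: simps)
  have F6: False if "y = Alcove (- p) (- q) True" "q \<ge> 2" "p \<ge> q" for p q
    using many[of "[((N1, 1 - q), [(N0, 0), (N0, 1), (N1, - q)]), ((N1, 1), [(N0, 0), (N0, 1), (N1, 0)]),
        ((N2, 0), [(N2, 1)]), ((N0, 1), [(N0, 0), (N2, q), (N2, q - 1)]),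
        ((N0, 1 - p), [(N0, 1 - p), (N1, 0), (N1, 1)]), ((N2, p + q - 2), [(N2, p + q - 1)])]"
        "Alcove (1 - p) (1 - q) True"] that by (simp add: simps)
  obtain a b e where y: "y = Alcove a b e" by (cases y)
  \<comment> \<open>The cases are the sign of the middle floor and the orientation. The small
    parameters that \<open>F1\<close> to \<open>F5\<close> leave open give the sporadic elements,
    and b = -1 with \<open>e\<close> gives the spirals.\<close>
  consider "b = 0" "\<not> e" | "b = 0" e | "b \<ge> 1" "\<not> e" | "b \<ge> 1" e | "b \<le> - 1" "\<not> e" | "b \<le> - 1" e
    by linarith
  then show ?thesis
  proof cases
    case 1
    then have "- a < 2" "a \<le> 0" using F1[of "- a"] y sorted by (force, simp)
    then have "a = 0 \<or> a = - 1" by presburger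
    then show ?thesis using y 1 by (auto simp: smooth_alcoves_def)
  next
    case 2
    then have "- a - 1 < 2" "a \<le> - 1" using F2[of "- a - 1"] y sorted by (force, simp)
    then have "a = - 1 \<or> a = - 2" by presburger
    then show ?thesis using y 2 by (auto simp: smooth_alcoves_def)
  next
    case 3
    define q where "q = - a - b"
    have q: "q \<ge> b" "a = - b - q" using y sorted 3 by (simp_all add: q_def)
    then have "q = 1" "b = 1" using F3[of b q] y 3 by force+
    then show ?thesis using y 3 q by (auto simp: smooth_alcoves_def)
  next
    case 4
    define q where "q = - a - b - 1"
    have q: "q \<ge> b" "a = - b - q - 1" using y sorted 4 by (simp_all add: q_def)
    then have "q = 1" "b = 1" using F4[of b q] y 4 by force+
    then show ?thesis using y 4 q F4' by auto
  next
    case 5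
    then have "- a \<ge> - b" "- a < 2" using F5[of "- a" "- b"] y sorted by (simp, force)
    then have "a = - 1" "b = - 1" using 5 by auto
    then show ?thesis using y 5 by (auto simp: smooth_alcoves_def)
  next
    case 6
    then have "- b < 2" using F6[of "- a" "- b"] y sorted by force
    then have "b = - 1" using 6 by simp
    moreover have "a = - (- a)" "- a \<ge> 1" using y sorted \<open>b = - 1\<close> by simp_all
    ultimately show ?thesis using y 6 unfolding smooth_alcoves_def by blast
  qed
qed

section \<open>Cubulations of lower intervals\<close>

text \<open>Arcs are only required to map to arcs, since a spanning subgraph need not be
  induced.\<close>

definition cubulates :: "nat list \<Rightarrow> (int list \<Rightarrow> alcove) \<Rightarrow> alcove \<Rightarrow> bool" where
  "cubulates ks f y \<longleftrightarrow> inj_on f (cubical_verts ks) \<and> f ` cubical_verts ks = ints base_alcove y \<and>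
    (\<forall>m\<in>cubical_verts ks. \<forall>i<length ks. m[i := m ! i + 1] \<in> cubical_verts ks \<longrightarrow>
      arc (f m) (f (m[i := m ! i + 1])))"

lemma sum_list_increment: "i < length m \<Longrightarrow> sum_list (m[i := m ! i + 1]) = sum_list m + (1 :: int)"
  by (induction m arbitrary: i) (auto simp: nth_Cons split: nat.splits)

text \<open>From every lattice point unit steps lead up to the top, so the image lies below
  \<open>y\<close>. Conversely it contains \<open>y\<close> and is closed under downward
  reflections, so it contains everything below \<open>y\<close>.\<close>

lemma cubulatesI:
  assumes inj: "inj_on f (cubical_verts ks)"
    and closed: "\<And>b i n. b \<in> f ` cubical_verts ks \<Longrightarrow> \<not> ups i n b \<Longrightarrow> mirror i n b \<in> f ` cubical_verts ks"
    and edge: "\<And>m i. m \<in> cubical_verts ks \<Longrightarrow> i < length ks \<Longrightarrow> m[i := m ! i + 1] \<in> cubical_verts ks \<Longrightarrow>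
      arc (f m) (f (m[i := m ! i + 1]))"
    and top: "f (map int ks) = y"
  shows "cubulates ks f y"
proof -
  have reach: "ble (f m) y" if "m \<in> cubical_verts ks" for m
    using that
  proof (induction "nat (sum_list (map int ks) - sum_list m)" arbitrary: m rule: less_induct)
    case less
    have m: "length m = length ks" "\<And>i. i < length ks \<Longrightarrow> 0 \<le> m ! i \<and> m ! i \<le> int (ks ! i)"
      using less.prems by (auto simp: cubical_verts_def)
    show ?case
    proof (cases "m = map int ks")
      case True
      then show ?thesis using top by simp
    next
      case False
      then obtain i where i: "i < length ks" "m ! i \<noteq> int (ks ! i)"
        using m(1) by (metis length_map nth_equalityI nth_map)
      define m' where "m' = m[i := m ! i + 1]"
      have "m ! i < int (ks ! i)" using m(2)[OF i(1)] i(2) by linarith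
      then have m': "m' \<in> cubical_verts ks"
        using m i by (auto simp: m'_def cubical_verts_def nth_list_update)
      have "sum_list m' = sum_list m + 1"
        using i m(1) by (simp add: m'_def sum_list_increment)
      moreover have "sum_list m' \<le> sum_list (map int ks)"
        using m' by (intro sum_list_mono2) (auto simp: cubical_verts_def)
      ultimately have "ble (f m') y" using less.hyps[of m'] m' by simp
      then show ?thesis using edge[OF less.prems i(1)] m' unfolding m'_def
        by (meson converse_rtranclp_into_rtranclp)
    qed
  qed
  have "map int ks \<in> cubical_verts ks" by (simp add: cubical_verts_def)
  then have y: "y \<in> f ` cubical_verts ks" using top by blast
  have "a \<in> f ` cubical_verts ks" if "ble a y" for a
    using that
  proof (induction rule: converse_rtranclp_induct)
    case (step a b)
    then obtain i n where b: "b = mirror i n a" "len a < len b" by (auto simp: arc_def)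
    then have "\<not> ups i n b" using arc_mirror_down[of i n b] step(1) by simp
    then show ?case using closed[OF step(3), of i n] b(1) by simp
  qed (rule y)
  then show ?thesis
    unfolding cubulates_def using inj edge reach base_ble by (auto simp: ints_def)
qed

lemma (in A2_tilde) cubulates_imp:
  assumes "cubulates ks f (alc y)" "ks \<noteq> []" "y \<in> carrier W"
  shows "can_be_cubulated (bruhat_interval_graph W S \<one> y)"
proof -
  let ?V = "cubical_verts ks" and ?G = "cubical_lattice ks" and ?I = "bruhat_interval W S \<one> y"
  let ?g = "elt \<circ> f"
  define H :: "('a, 'a \<times> 'a) pre_digraph" where
    "H = \<lparr>verts = ?g ` ?V, arcs = map_prod ?g ?g ` arcs ?G, tail = fst, head = snd\<rparr>"
  have vertsG: "verts ?G = ?V" and endsG: "tail ?G = fst" "head ?G = snd"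
    by (simp_all add: cubical_lattice_def)
  have fV: "f ` ?V = ints base_alcove (alc y)"
    using assms(1) by (simp add: cubulates_def)
  have I: "?I = ?g ` ?V"
    unfolding image_comp[symmetric] fV using bruhat_interval_eq[of \<one> y] assms(3) by simp
  have arcsG: "u \<in> ?V \<and> v \<in> ?V \<and> arc (f u) (f v)" if "(u, v) \<in> arcs ?G" for u v
    using that assms(1) by (auto simp: cubical_lattice_def cubulates_def)
  have wfG: "wf_digraph ?G"
    using arcsG by unfold_locales (auto simp: vertsG endsG)
  have endsB: "tail (bruhat_graph W S) = fst" "head (bruhat_graph W S) = snd"
    by (simp_all add: bruhat_graph_def)
  have wfB: "wf_digraph (bruhat_graph W S)"
    by unfold_locales (auto simp: verts_bruhat arcs_bruhat endsB)
  have inj: "inj_on ?g ?V"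
    using assms(1) by (auto simp: cubulates_def intro!: comp_inj_on inj_elt)
  have "arcs ?G \<subseteq> ?V \<times> ?V" using arcsG by auto
  then have inja: "inj_on (map_prod ?g ?g) (arcs ?G)"
    using map_prod_inj_on[OF inj inj] by (rule inj_on_subset[rotated])
  have "spanning H (bruhat_interval_graph W S \<one> y)"
  proof -
    have "arcs H \<subseteq> arcs (bruhat_interval_graph W S \<one> y)"
      using arcsG by (fastforce simp: H_def bruhat_interval_graph_def I arcs_bruhat endsB)
    moreover have "wf_digraph (bruhat_interval_graph W S \<one> y)"
      unfolding bruhat_interval_graph_def by (rule wf_digraph.wellformed_induce_subgraph[OF wfB])
    moreover have "wf_digraph H"
      using arcsG by unfold_locales (auto simp: H_def)
    moreover have "compatible (bruhat_interval_graph W S \<one> y) H"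
      by (simp add: compatible_def H_def bruhat_interval_graph_def endsB)
    ultimately show ?thesis
      by (simp add: spanning_def subgraph_def H_def bruhat_interval_graph_def I)
  qed
  moreover have "digraph_iso ?G H"
  proof -
    let ?h = "\<lparr>iso_verts = ?g, iso_arcs = map_prod ?g ?g, iso_head = snd, iso_tail = fst\<rparr>"
    have "pre_digraph.digraph_isomorphism ?G ?h"
      using wfG inj inja by (auto simp: pre_digraph.digraph_isomorphism_def vertsG endsG)
    moreover have "H = app_iso ?h ?G" by (simp add: app_iso_def H_def vertsG)
    ultimately show ?thesis unfolding digraph_iso_def by blast
  qed
  ultimately show ?thesis using assms(2) unfolding can_be_cubulated_def by blast
qed

subsection \<open>The infinite family\<close>

text \<open>The sides are perpendicular to the lines x_i = n: a reflection in such a line keeps the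
  difference of the other two floors and exchanges the remaining differences up to a shift. The
  staggered bounds make the set invariant under \<open>simple N0\<close> and
  \<open>simple N1\<close>.\<close>

definition triangle :: "int \<Rightarrow> alcove set" where
  "triangle k = {a. coord N0 a - coord N2 a \<le> k - 1 \<and> coord N1 a - coord N0 a \<le> k \<and>
    coord N2 a - coord N1 a \<le> k + 1}"

lemma triangle_simple: "i \<noteq> N2 \<Longrightarrow> simple i a \<in> triangle k \<longleftrightarrow> a \<in> triangle k"
  by (cases i) (auto simp: triangle_def coord_mirror)

lemma triangle_closed:
  assumes "a \<in> triangle k" "\<not> ups i n a"
  shows "mirror i n a \<in> triangle k"
  using assms coord_sum[of a] by (cases i) (auto simp: triangle_def ups_def coord_mirror split: if_splits)

text \<open>
  The triangle is a union of cosets of the stabiliser \<open>\<langle>s\<^sub>0, s\<^sub>1\<rangle>\<close> of a vertex. For \<open>j \<ge> l\<close> the alcove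
  \<open>quot_alcove j l\<close> runs through the minimal coset representatives, for \<open>j < l\<close> through their
  images under \<open>s\<^sub>0\<close>; the remaining coordinate of the lattice applies \<open>1\<close>, \<open>s\<^sub>1\<close> or \<open>s\<^sub>0 s\<^sub>1\<close>.
\<close>

fun quot_alcove :: "int \<Rightarrow> int \<Rightarrow> alcove" where
  "quot_alcove j l = Alcove ((j - l) div 2) (l + min 0 ((j - l) div 2)) (odd (j + l))"

fun turn :: "node \<Rightarrow> node \<Rightarrow> int \<Rightarrow> alcove \<Rightarrow> alcove" where
  "turn p r i a = (if i = 0 then a else if i = 1 then simple p a else simple r (simple p a))"

fun spiral :: "int list \<Rightarrow> alcove" where
  "spiral [i, j, l] = turn N1 N0 i (quot_alcove j l)"
| "spiral _ = base_alcove"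

text \<open>The two inequalities cut out the dominant chamber of \<open>simple N0\<close>,
  \<open>simple N1\<close> together with its image under \<open>simple N0\<close>. This is a third
  of the plane, and the three maps \<open>turn N1 N0 i\<close> carry it to the three thirds.\<close>

lemma quot_alcove_sector:
  assumes "0 \<le> j" "0 \<le> l"
  shows "coord N1 (quot_alcove j l) \<ge> 0" "coord N2 (quot_alcove j l) \<le> 0"
proof -
  define d where "d = (j - l) div 2"
  have "j - l = 2 * d + of_bool (odd (j + l))" unfolding d_def by (simp add: of_bool_def)
  then show "coord N1 (quot_alcove j l) \<ge> 0" "coord N2 (quot_alcove j l) \<le> 0"
    using assms unfolding quot_alcove.simps d_def[symmetric] by (auto simp: of_bool_def split: if_splits)
qed

text \<open>Each unit step is a reflection. Its line depends on the parity of \<open>j + l\<close>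
  and on the sign of \<open>d\<close>, because of the kink of \<open>min 0 d\<close> in the second
  floor.\<close>

lemma quot_alcove_arcs:
  assumes "0 \<le> j" "0 \<le> l"
  shows "arc (quot_alcove j l) (quot_alcove (j + 1) l)" "arc (quot_alcove j l) (quot_alcove j (l + 1))"
proof -
  define d where "d = (j - l) div 2"
  have d: "(j - l) div 2 = d" by (simp add: d_def)
  consider (even) "even (j + l)" | (odd) "odd (j + l)" by blast
  then have "arc (quot_alcove j l) (quot_alcove (j + 1) l) \<and> arc (quot_alcove j l) (quot_alcove j (l + 1))"
  proof cases
    case even
    then have jl: "j = l + 2 * d" using d by presburger
    have "(j + 1 - l) div 2 = d" "(j - (l + 1)) div 2 = d - 1" unfolding jl by presburger+
    then show ?thesis
      using assms even d jl
        arc_mirror[of "quot_alcove j l" N2 "- d - (l + min 0 d)"]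
        arc_mirror[of "quot_alcove j l" N1 "l + 1"] arc_mirror[of "quot_alcove j l" N0 d]
      by (cases d "0 :: int" rule: linorder_cases) (auto simp: ups_def min_def ac_simps split: if_splits)
  next
    case odd
    then have jl: "j = l + 2 * d + 1" using d by presburger
    have "(j + 1 - l) div 2 = d + 1" "(j - (l + 1)) div 2 = d" unfolding jl by presburger+
    then show ?thesis
      using assms odd d jl
        arc_mirror[of "quot_alcove j l" N0 "d + 1"]
        arc_mirror[of "quot_alcove j l" N2 "- 1 - l - 2 * d"]
        arc_mirror[of "quot_alcove j l" N1 "l + 1 + min 0 d"]
      by (cases d "- 1 :: int" rule: linorder_cases)
        (auto simp: ups_def min_def algebra_simps split: if_splits)
  qed
  then show "arc (quot_alcove j l) (quot_alcove (j + 1) l)" "arc (quot_alcove j l) (quot_alcove j (l + 1))"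
    by auto
qed

text \<open>Inside the sector an arc is never a step by \<open>simple N1\<close>, nor is its image
  under \<open>simple N1\<close> a step by \<open>simple N0\<close>; so \<open>arc_simple\<close>
  applies twice.\<close>

lemma turn_arc:
  assumes "arc a b" "coord N1 a \<ge> 0" "coord N2 a \<le> 0" "coord N1 b \<ge> 0" "coord N2 b \<le> 0"
  shows "arc (turn N1 N0 i a) (turn N1 N0 i b)"
proof -
  have "b \<noteq> simple N1 a"
    using assms by (auto simp: coord_mirror)
  then have 1: "arc (simple N1 a) (simple N1 b)" by (rule arc_simple[OF assms(1)])
  have "simple N1 b \<noteq> simple N0 (simple N1 a)"
    using assms by (auto simp: coord_mirror dest!: arg_cong[of _ _ "coord N0"])
  then have "arc (simple N0 (simple N1 a)) (simple N0 (simple N1 b))" by (rule arc_simple[OF 1])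
  then show ?thesis using 1 assms(1) by simp
qed

lemma turn_inj:
  assumes "turn N1 N0 i a = turn N1 N0 i' b" "i \<in> {0, 1, 2}" "i' \<in> {0, 1, 2}"
    "coord N1 a \<ge> 0" "coord N2 a \<le> 0" "coord N1 b \<ge> 0" "coord N2 b \<le> 0"
  shows "i = i' \<and> a = b"
proof -
  have "i = i'"
    using assms(2-) arg_cong[OF assms(1), of "coord N0"] arg_cong[OF assms(1), of "coord N1"]
      arg_cong[OF assms(1), of "coord N2"]
    by (auto simp: coord_mirror)
  then show ?thesis using assms(1) by (auto simp: mirror_eq_iff split: if_splits)
qed

lemma quot_alcove_inj: "quot_alcove j l = quot_alcove j' l' \<Longrightarrow> j = j' \<and> l = l'"
proof
  assume "quot_alcove j l = quot_alcove j' l'"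
  then have eq: "(j - l) div 2 = (j' - l') div 2" "l + min 0 ((j - l) div 2) = l' + min 0 ((j' - l') div 2)"
      "odd (j + l) = odd (j' + l')"
    unfolding quot_alcove.simps alcove.inject by blast+
  show l: "l = l'" using eq(2) unfolding eq(1) by simp
  have "j - l = 2 * ((j - l) div 2) + of_bool (odd (j + l))"
      "j' - l = 2 * ((j' - l) div 2) + of_bool (odd (j' + l))"
    by (simp_all add: of_bool_def)
  then show "j = j'" using eq l by simp
qed

lemma quot_alcove_surj:
  assumes "a \<in> triangle k" "coord N1 a \<ge> 0" "coord N2 a \<le> 0"
  shows "\<exists>j l. 0 \<le> j \<and> j \<le> k - 1 \<and> 0 \<le> l \<and> l \<le> k \<and> a = quot_alcove j l"
proof -
  obtain d b e where a: "a = Alcove d b e" by (cases a)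
  define l where "l = b - min 0 d"
  define j where "j = l + 2 * d + of_bool e"
  have "(j - l) div 2 = d" "odd (j + l) = e" by (auto simp: j_def of_bool_def)
  then have "a = quot_alcove j l" by (simp add: a l_def)
  moreover have "0 \<le> j \<and> j \<le> k - 1 \<and> 0 \<le> l \<and> l \<le> k"
    using assms unfolding a by (auto simp: triangle_def j_def l_def min_def of_bool_def split: if_splits)
  ultimately show ?thesis by blast
qed

lemma quot_alcove_triangle:
  assumes "0 \<le> j" "j \<le> k - 1" "0 \<le> l" "l \<le> k"
  shows "quot_alcove j l \<in> triangle k"
proof -
  define d where "d = (j - l) div 2"
  have "j - l = 2 * d + of_bool (odd (j + l))" unfolding d_def by (simp add: of_bool_def)
  then show ?thesis
    using assms unfolding quot_alcove.simps d_def[symmetric]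
    by (auto simp: triangle_def of_bool_def split: if_splits)
qed

lemma cubical_verts_Cons: "cubical_verts (k # ks) = {x # xs | x xs. 0 \<le> x \<and> x \<le> int k \<and> xs \<in> cubical_verts ks}"
proof -
  have "m \<in> cubical_verts (k # ks) \<longleftrightarrow> m \<in> {x # xs | x xs. 0 \<le> x \<and> x \<le> int k \<and> xs \<in> cubical_verts ks}" for m
    by (cases m) (auto simp: cubical_verts_def All_less_Suc2)
  then show ?thesis by blast
qed

lemma cubical_verts_Nil: "cubical_verts [] = {[]}"
  by (auto simp: cubical_verts_def)

lemma cubical_verts_3:
  "cubical_verts [k1, k2, k3] =
    {[x, y, z] | x y z. 0 \<le> x \<and> x \<le> int k1 \<and> 0 \<le> y \<and> y \<le> int k2 \<and> 0 \<le> z \<and> z \<le> int k3}"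
  by (auto simp: cubical_verts_Cons cubical_verts_Nil)

lemma spiral_image:
  assumes "k \<ge> 1"
  shows "spiral ` cubical_verts [2, k - 1, k] = triangle (int k)"
proof
  show "spiral ` cubical_verts [2, k - 1, k] \<subseteq> triangle (int k)"
    using assms by (auto simp: cubical_verts_3 triangle_simple simp del: quot_alcove.simps intro!: quot_alcove_triangle)
next
  show "triangle (int k) \<subseteq> spiral ` cubical_verts [2, k - 1, k]"
  proof
    fix w assume w: "w \<in> triangle (int k)"
    have im: "w \<in> spiral ` cubical_verts [2, k - 1, k]"
      if a: "w = turn N1 N0 i a" "i \<in> {0, 1, 2}" "a \<in> triangle (int k)" "coord N1 a \<ge> 0" "coord N2 a \<le> 0" for i a
    proof -
      obtain j l where "0 \<le> j" "j \<le> int k - 1" "0 \<le> l" "l \<le> int k" "a = quot_alcove j l"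
        using quot_alcove_surj[OF a(3-5)] by blast
      then show ?thesis
        using a(1,2) assms by (intro image_eqI[of _ _ "[i, j, l]"]) (auto simp: cubical_verts_3)
    qed
    \<comment> \<open>The sector and its images under \<open>turn N1 N0 1\<close> and
      \<open>turn N1 N0 2\<close>.\<close>
    consider "coord N1 w \<ge> 0" "coord N2 w \<le> 0" | "coord N0 w \<ge> 0" "coord N1 w < 0" |
      "coord N0 w < 0" "coord N2 w \<ge> 1"
      using coord_sum[of w] by force
    then show "w \<in> spiral ` cubical_verts [2, k - 1, k]"
    proof cases
      case 1
      then show ?thesis using w by (intro im[of 0 w]) auto
    next
      case 2
      then show ?thesis using w by (intro im[of 1 "simple N1 w"]) (auto simp: triangle_simple coord_mirror)
    next
      case 3
      then show ?thesis using w
        by (intro im[of 2 "simple N1 (simple N0 w)"]) (auto simp: triangle_simple coord_mirror)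
    qed
  qed
qed

lemma cubulates_spiral:
  assumes "k \<ge> 1"
  shows "cubulates [2, k - 1, k] spiral (Alcove (- int k) (- 1) True)"
proof (rule cubulatesI)
  show "inj_on spiral (cubical_verts [2, k - 1, k])"
  proof (rule inj_onI)
    fix m m' assume m: "m \<in> cubical_verts [2, k - 1, k]" "m' \<in> cubical_verts [2, k - 1, k]" "spiral m = spiral m'"
    have three: "x \<in> {0, 1, 2}" if "0 \<le> x" "x \<le> 2" for x :: int
      using that by auto
    obtain i j l i' j' l' where e: "m = [i, j, l]" "m' = [i', j', l']" "i \<in> {0, 1, 2}" "i' \<in> {0, 1, 2}"
        "0 \<le> j" "0 \<le> l" "0 \<le> j'" "0 \<le> l'"
      using m(1,2) three unfolding cubical_verts_3 by auto
    then have "i = i' \<and> quot_alcove j l = quot_alcove j' l'"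
      using m(3) by (intro turn_inj quot_alcove_sector) simp_all
    then show "m = m'" using e quot_alcove_inj by blast
  qed
next
  fix b i n assume "b \<in> spiral ` cubical_verts [2, k - 1, k]" "\<not> ups i n b"
  then show "mirror i n b \<in> spiral ` cubical_verts [2, k - 1, k]"
    unfolding spiral_image[OF assms] by (rule triangle_closed)
next
  fix m i assume m: "m \<in> cubical_verts [2, k - 1, k]" "i < length [2, k - 1, k]"
    "m[i := m ! i + 1] \<in> cubical_verts [2, k - 1, k]"
  obtain x j l where e: "m = [x, j, l]" "0 \<le> x" "0 \<le> j" "0 \<le> l"
    using m(1) by (auto simp: cubical_verts_3)
  note sector = quot_alcove_sector[OF e(3,4)]
  have zero_or_one: "x = 0 \<or> x = 1" if "x \<le> 1"
    using that e(2) by linarith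
  consider "i = 0" "x = 0 \<or> x = 1" | "i = 1" | "i = 2"
    using m(2,3) e zero_or_one by (cases i) (auto simp: cubical_verts_3 less_Suc_eq)
  then show "arc (spiral m) (spiral (m[i := m ! i + 1]))"
  proof cases
    case 1
    then show ?thesis
      using sector arc_ascent[of N1 "quot_alcove j l"] arc_ascent[of N0 "simple N1 (quot_alcove j l)"]
      by (auto simp: e coord_mirror simp del: quot_alcove.simps)
  next
    case 2
    then show ?thesis
      using turn_arc[OF quot_alcove_arcs(1)[OF e(3,4)] sector quot_alcove_sector[of "j + 1" l]] e
      by (simp del: quot_alcove.simps turn.simps)
  next
    case 3
    then show ?thesis
      using turn_arc[OF quot_alcove_arcs(2)[OF e(3,4)] sector quot_alcove_sector[of j "l + 1"]] e
      by (simp add: numeral_2_eq_2 del: quot_alcove.simps turn.simps)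
  qed
next
  show "spiral (map int [2, k - 1, k]) = Alcove (- int k) (- 1) True"
    using assms by (simp add: of_nat_diff)
qed

subsection \<open>The sporadic intervals\<close>

text \<open>The two integer intervals list the \<open>n\<close> with
  \<open>\<not> ups i n b\<close>, which makes closure under downward reflections
  executable.\<close>

definition down_closed :: "alcove list \<Rightarrow> bool" where
  "down_closed A \<longleftrightarrow> (\<forall>b\<in>set A. \<forall>i\<in>set [N0, N1, N2].
    \<forall>n\<in>set ([1..coord i b] @ [coord i b + 1..0]). mirror i n b \<in> set A)"

fun box :: "nat list \<Rightarrow> int list list" where
  "box [] = [[]]"
| "box (k # ks) = concat (map (\<lambda>x. map ((#) x) (box ks)) [0..int k])"

text \<open>As \<open>coord i b = 2 * n - 1 - coord i a\<close> for a reflection in x_i = n, the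
  only candidate for \<open>n\<close> can be computed.\<close>

definition is_arc :: "alcove \<Rightarrow> alcove \<Rightarrow> bool" where
  "is_arc a b \<longleftrightarrow> len a < len b \<and>
    (\<exists>i\<in>set [N0, N1, N2]. b = mirror i ((coord i a + coord i b + 1) div 2) a)"

definition cubulation_check :: "nat list \<Rightarrow> (int list \<Rightarrow> alcove) \<Rightarrow> bool" where
  "cubulation_check ks f \<longleftrightarrow> distinct (map f (box ks)) \<and> down_closed (map f (box ks)) \<and>
    (\<forall>m\<in>set (box ks). \<forall>i\<in>set [0..<length ks]. m ! i + 1 \<le> int (ks ! i) \<longrightarrow>
      is_arc (f m) (f (m[i := m ! i + 1])))"

lemma set_box: "set (box ks) = cubical_verts ks"
  by (induction ks) (auto simp: cubical_verts_Nil cubical_verts_Cons)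

lemma cubulation_check:
  assumes "cubulation_check ks f"
  shows "cubulates ks f (f (map int ks))"
proof (rule cubulatesI)
  show "inj_on f (cubical_verts ks)"
    using assms by (simp add: cubulation_check_def distinct_map set_box)
next
  fix b i n assume b: "b \<in> f ` cubical_verts ks" "\<not> ups i n b"
  have "i \<in> set [N0, N1, N2]" using UNIV_node by auto
  moreover have "n \<in> set ([1..coord i b] @ [coord i b + 1..0])"
    using b(2) by (auto simp: ups_def split: if_splits)
  ultimately have "mirror i n b \<in> set (map f (box ks))"
    using assms b(1) unfolding cubulation_check_def down_closed_def by (metis set_box set_map)
  then show "mirror i n b \<in> f ` cubical_verts ks" by (simp add: set_box)
next
  fix m i assume m: "m \<in> cubical_verts ks" "i < length ks" "m[i := m ! i + 1] \<in> cubical_verts ks"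
  have "length m = length ks" using m(1) by (simp add: cubical_verts_def)
  then have "m ! i + 1 \<le> int (ks ! i)"
    using m(2,3) by (auto simp: cubical_verts_def)
  then have "is_arc (f m) (f (m[i := m ! i + 1]))"
    using assms m unfolding cubulation_check_def by (simp add: set_box)
  then show "arc (f m) (f (m[i := m ! i + 1]))"
    unfolding is_arc_def arc_def by blast
qed simp

definition flip :: "node \<Rightarrow> int \<Rightarrow> alcove \<Rightarrow> alcove" where
  "flip i x a = (if x = 1 then simple i a else a)"

lemma smooth_cubulates:
  assumes "y \<in> smooth_alcoves"
  shows "\<exists>ks f. ks \<noteq> [] \<and> cubulates ks f y"
proof -
  have check: "\<exists>ks f. ks \<noteq> [] \<and> cubulates ks f z"
    if "cubulation_check ks f" "f (map int ks) = z" "ks \<noteq> []" for ks f z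
    using cubulation_check[OF that(1)] that(2,3) by blast
  consider "y = Alcove 0 0 False" | "y = Alcove (- 1) 0 True" | "y = Alcove (- 1) 0 False" |
    "y = Alcove (- 2) 0 True" | "y = Alcove (- 2) 1 False" | "y = Alcove (- 1) (- 1) False" |
    k where "y = Alcove (- k) (- 1) True" "k \<ge> 1"
    using assms by (auto simp: smooth_alcoves_def)
  then show ?thesis
  proof cases
    \<comment> \<open>The witnesses mimic factorizations of the lower intervals:
      \<open>flip i\<close> contributes 1 or s_i, and \<open>turn p r\<close> contributes 1, s_p or
      s_p s_r.\<close>
    case 1
    show ?thesis unfolding 1 by (rule check[of "[0]" "\<lambda>m. base_alcove"]; code_simp)
  next
    case 2
    show ?thesis unfolding 2 by (rule check[of "[1]" "\<lambda>m. flip N0 (m ! 0) base_alcove"]; code_simp)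
  next
    case 3
    show ?thesis unfolding 3
      by (rule check[of "[1, 1]" "\<lambda>m. flip N0 (m ! 1) (flip N1 (m ! 0) base_alcove)"]; code_simp)
  next
    case 4
    show ?thesis unfolding 4
      by (rule check[of "[1, 1, 1]"
        "\<lambda>m. flip N0 (m ! 2) (flip N1 (m ! 1) (flip N2 (m ! 0) base_alcove))"]; code_simp)
  next
    case 5
    show ?thesis unfolding 5
      by (rule check[of "[1, 1, 2]"
        "\<lambda>m. flip N0 (m ! 0) (turn N1 N2 (m ! 2) (flip N2 (m ! 1) base_alcove))"]; code_simp)
  next
    case 6
    show ?thesis unfolding 6
      by (rule check[of "[1, 1, 2]"
        "\<lambda>m. turn N1 N0 (m ! 2) (flip N0 (m ! 1) (flip N2 (m ! 0) base_alcove))"]; code_simp)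
  next
    case 7
    then show ?thesis using cubulates_spiral[of "nat k"]
      by (intro exI[of _ "[2, nat k - 1, nat k]"] exI[of _ spiral]) simp
  qed
qed

section \<open>Infinitely many smooth elements\<close>

text \<open>
  The operator \<open>hecke 1 q i\<close> is right multiplication by \<open>1 + T\<^sub>i\<close> on coefficient functions
  \<open>\<Sum>a. X a * T\<^sub>a\<close>, and \<open>hecke q 1 i\<close> is its counterpart under the bar involution. Treating both
  at once makes bar invariance of a combination a matter of a single identity.
\<close>

definition hecke :: "int poly \<Rightarrow> int poly \<Rightarrow> node \<Rightarrow> (alcove \<Rightarrow> int poly) \<Rightarrow> alcove \<Rightarrow> int poly" where
  "hecke \<alpha> \<beta> i X a = (if coord i a \<ge> 0 then \<alpha> * X a + \<beta> * X (simple i a) else \<alpha> * X (simple i a) + \<beta> * X a)"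

text \<open>With C_i = 1 + T_i one has C_j C_i C_j = C_jij + q C_j, where C_jij is the sum of all
  six T_w. Subtracting q therefore turns functions invariant under \<open>simple j\<close> into
  functions invariant under both reflections.\<close>

definition hecke2 :: "int poly \<Rightarrow> int poly \<Rightarrow> node \<Rightarrow> node \<Rightarrow> (alcove \<Rightarrow> int poly) \<Rightarrow> alcove \<Rightarrow> int poly" where
  "hecke2 \<alpha> \<beta> i j X a = hecke \<alpha> \<beta> j (hecke \<alpha> \<beta> i X) a - \<alpha> * \<beta> * X a"

text \<open>\<open>Z\<close> lists the coefficients of the bar image of \<open>X\<close>, with q
  replaced by its inverse in each of them. This keeps everything polynomial and makes the relation
  linear instead of semilinear.\<close>

definition dual :: "(alcove \<Rightarrow> int poly) \<Rightarrow> (alcove \<Rightarrow> int poly) \<Rightarrow> bool" where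
  "dual X Z \<longleftrightarrow> finite {a. X a \<noteq> 0} \<and> (\<forall>u. qq ^ len u * (\<Sum>a | X a \<noteq> 0. X a * R u a) = Z u)"

lemma dual_sum:
  assumes "dual X Z" "finite A" "{a. X a \<noteq> 0} \<subseteq> A"
  shows "qq ^ len u * (\<Sum>a\<in>A. X a * R u a) = Z u"
proof -
  have "(\<Sum>a | X a \<noteq> 0. X a * R u a) = (\<Sum>a\<in>A. X a * R u a)"
    using assms by (intro sum.mono_neutral_left) auto
  then show ?thesis using assms(1) unfolding dual_def by metis
qed

lemma dualI:
  assumes "finite A" "{a. X a \<noteq> 0} \<subseteq> A" "\<And>u. qq ^ len u * (\<Sum>a\<in>A. X a * R u a) = Z u"
  shows "dual X Z"
proof -
  have "(\<Sum>a | X a \<noteq> 0. X a * R u a) = (\<Sum>a\<in>A. X a * R u a)" for u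
    using assms by (intro sum.mono_neutral_left) auto
  then show ?thesis using assms by (auto simp: dual_def intro: finite_subset)
qed

lemma dual_add:
  assumes "dual X Z" "dual X' Z'"
  shows "dual (\<lambda>a. X a + X' a) (\<lambda>a. Z a + Z' a)"
proof (rule dualI)
  let ?A = "{a. X a \<noteq> 0} \<union> {a. X' a \<noteq> 0}"
  show fin: "finite ?A" using assms by (simp add: dual_def)
  show "qq ^ len u * (\<Sum>a\<in>?A. (X a + X' a) * R u a) = Z u + Z' u" for u
    using dual_sum[OF assms(1) fin, of u] dual_sum[OF assms(2) fin, of u]
    by (simp add: distrib_left distrib_right sum.distrib)
qed auto

lemma dual_mult:
  assumes "dual X Z"
  shows "dual (\<lambda>a. c * X a) (\<lambda>a. c * Z a)"
proof (rule dualI)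
  let ?A = "{a. X a \<noteq> 0}"
  show fin: "finite ?A" using assms by (simp add: dual_def)
  show "qq ^ len u * (\<Sum>a\<in>?A. (c * X a) * R u a) = c * Z u" for u
    using dual_sum[OF assms fin, of u] by (simp add: mult.assoc sum_distrib_left[symmetric])
qed auto

lemma dual_diff: "dual X Z \<Longrightarrow> dual X' Z' \<Longrightarrow> dual (\<lambda>a. X a - X' a) (\<lambda>a. Z a - Z' a)"
  using dual_add[of X Z "\<lambda>a. - 1 * X' a" "\<lambda>a. - 1 * Z' a"] dual_mult[of X' Z' "- 1"] by simp

lemma dual_hecke:
  assumes "dual X Z"
  shows "dual (hecke 1 qq i X) (hecke qq 1 i Z)"
proof (rule dualI)
  let ?S = "{a. X a \<noteq> 0}"
  let ?A = "?S \<union> simple i ` ?S"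
  show fin: "finite ?A" using assms by (simp add: dual_def)
  have stable: "simple i a \<in> ?A" if "a \<in> ?A" for a using that by auto
  show "{a. hecke 1 qq i X a \<noteq> 0} \<subseteq> ?A"
  proof
    fix a assume "a \<in> {a. hecke 1 qq i X a \<noteq> 0}"
    then have "a \<in> ?S \<or> simple i a \<in> ?S" by (auto simp: hecke_def split: if_splits)
    then show "a \<in> ?A" by (auto intro: image_eqI[of _ _ "simple i a"])
  qed
  fix u
  define F where "F u = (\<Sum>a\<in>?A. X a * R u a)" for u
  have Z: "Z u = qq ^ len u * F u" for u
    unfolding F_def using dual_sum[OF assms fin] by simp
  have pairs: "(\<Sum>a\<in>?A. h a) = (\<Sum>a\<in>{a\<in>?A. coord i a \<ge> 0}. h a + h (simple i a))" for h :: "alcove \<Rightarrow> int poly"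
    by (rule sum_pairs[OF fin stable])
  have H: "hecke 1 qq i X a = X a + qq * X (simple i a)"
      "hecke 1 qq i X (simple i a) = X a + qq * X (simple i a)" if "coord i a \<ge> 0" for a
    using that by (simp_all add: hecke_def coord_mirror)
  show "qq ^ len u * (\<Sum>a\<in>?A. hecke 1 qq i X a * R u a) = hecke qq 1 i Z u"
  proof (cases "coord i u \<ge> 0")
    case True
    have R: "R u (simple i a) = qq * R (simple i u) a + (qq - 1) * R u a"
        "R (simple i u) (simple i a) = R u a" if "coord i a \<ge> 0" for a
      using that True R_rec[of i "simple i a" u] R_rec[of i "simple i a" "simple i u"]
      by (simp_all add: coord_mirror)
    have "(\<Sum>a\<in>?A. hecke 1 qq i X a * R u a) = qq * F u + qq * F (simple i u)"
      unfolding F_def pairs sum_distrib_left sum.distrib[symmetric]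
      by (intro sum.cong refl) (simp add: H R algebra_simps)
    moreover have "len (simple i u) = Suc (len u)" using True by (simp add: len_simple)
    ultimately show ?thesis using True by (simp add: hecke_def Z algebra_simps)
  next
    case False
    have R: "R u (simple i a) = R (simple i u) a"
        "R (simple i u) (simple i a) = qq * R u a + (qq - 1) * R (simple i u) a" if "coord i a \<ge> 0" for a
      using that False R_rec[of i "simple i a" u] R_rec[of i "simple i a" "simple i u"]
      by (simp_all add: coord_mirror)
    have "(\<Sum>a\<in>?A. hecke 1 qq i X a * R u a) = F u + F (simple i u)"
      unfolding F_def pairs sum.distrib[symmetric]
      by (intro sum.cong refl) (simp add: H R algebra_simps)
    moreover have "len u = Suc (len (simple i u))" using False len_simple[of i u] len_pos[of i u] by simp
    ultimately show ?thesis using False by (simp add: hecke_def Z algebra_simps)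
  qed
qed

lemma dual_hecke2: "dual X Z \<Longrightarrow> dual (hecke2 1 qq i j X) (hecke2 qq 1 i j Z)"
  using dual_diff[OF dual_hecke[OF dual_hecke, of X Z j i] dual_mult[of X Z qq]]
  by (simp add: hecke2_def[abs_def])

lemma hecke_simple: "hecke \<alpha> \<beta> i X (simple i a) = hecke \<alpha> \<beta> i X a"
  by (auto simp: hecke_def coord_mirror)

lemma hecke2_simple:
  assumes "i \<noteq> j" "\<And>a. X (simple j a) = X a"
  shows "hecke2 \<alpha> \<beta> i j X (simple j a) = hecke2 \<alpha> \<beta> i j X a"
    and "hecke2 \<alpha> \<beta> i j X (simple i a) = hecke2 \<alpha> \<beta> i j X a"
proof -
  show "hecke2 \<alpha> \<beta> i j X (simple j a) = hecke2 \<alpha> \<beta> i j X a"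
    by (simp add: hecke2_def hecke_simple assms(2))
  let ?c = "coord j (simple i a)"
  have c: "coord i (simple j a) = ?c" "coord i (simple j (simple i a)) = coord j a"
    using assms(1) by (cases i; cases j; simp add: coord_mirror)+
  have sgn: "coord i a \<ge> 0 \<and> coord j a \<ge> 0 \<longrightarrow> ?c \<ge> 0" "?c \<ge> 0 \<longrightarrow> coord i a \<ge> 0 \<or> coord j a \<ge> 0"
    using assms(1) coord_sum[of a] by (cases i; cases j; auto simp: coord_mirror)+
  have X: "X (simple i (simple j (simple i a))) = X (simple i (simple j a))"
    using simple_braid[OF assms(1), of a] assms(2) by simp
  have "coord i (simple i a) \<ge> 0 \<longleftrightarrow> \<not> coord i a \<ge> 0" by (auto simp: coord_mirror)
  then show "hecke2 \<alpha> \<beta> i j X (simple i a) = hecke2 \<alpha> \<beta> i j X a"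
    using sgn unfolding hecke2_def hecke_def
    by (cases "coord i a \<ge> 0"; cases "coord j a \<ge> 0"; cases "?c \<ge> 0"; simp add: c X assms(2) algebra_simps)
qed

lemma hecke2_dominant:
  assumes "i \<noteq> j" "\<And>a. X (simple j a) = X a" "coord i a \<ge> 0" "coord j a \<ge> 0"
  shows "hecke2 \<alpha> \<beta> i j X a =
    \<alpha> ^ 2 * X a + \<alpha> * \<beta> * X (simple i a) + \<beta> ^ 2 * X (simple i (simple j a))"
proof -
  have "coord i (simple j a) \<ge> 0"
    using assms(1,3,4) coord_sum[of a] by (cases i; cases j; auto simp: coord_mirror)
  then show ?thesis
    using assms(2-) by (simp add: hecke2_def hecke_def algebra_simps power2_eq_square)
qed

lemma eq_if_eq_dominant:
  fixes f g :: "alcove \<Rightarrow> int poly"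
  assumes "\<And>a. f (simple i a) = f a" "\<And>a. f (simple j a) = f a"
    "\<And>a. g (simple i a) = g a" "\<And>a. g (simple j a) = g a"
    "\<And>a. coord i a \<ge> 0 \<Longrightarrow> coord j a \<ge> 0 \<Longrightarrow> f a = g a"
  shows "f = g"
proof
  fix a
  show "f a = g a"
  proof (induction "len a" arbitrary: a rule: less_induct)
    case less
    show ?case
      using less[of "simple i a"] less[of "simple j a"] assms descent_iff by (metis not_less)
  qed
qed

section \<open>Triangles with permuted labels and their recursion\<close>

definition tri :: "int \<Rightarrow> node \<Rightarrow> node \<Rightarrow> node \<Rightarrow> alcove set" where
  "tri k p r m = {a. coord p a - coord m a \<le> k - 1 \<and> coord r a - coord p a \<le> k \<and>
    coord m a - coord r a \<le> k + 1}"

text \<open>The exponent is the length of the top element. Bar invariance says that the functions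
  for \<alpha> = 1 and \<alpha> = q are dual. For k below 0 the truncated exponent is harmless,
  since the triangle is empty.\<close>

definition triangle_fun :: "int poly \<Rightarrow> int \<Rightarrow> node \<Rightarrow> node \<Rightarrow> node \<Rightarrow> alcove \<Rightarrow> int poly" where
  "triangle_fun \<alpha> k p r m a = of_bool (a \<in> tri k p r m) * \<alpha> ^ nat (2 * k + 1)"

lemma third_eq: "distinct [p, r, m] \<Longrightarrow> third p r = m \<and> third p m = r \<and> third r m = p \<and>
    third r p = m \<and> third m p = r \<and> third m r = p"
  by (cases p; cases r; cases m; simp)

lemma coord_sum_distinct:
  "distinct [p, r, m] \<Longrightarrow> coord p a + coord r a + coord m a = 0 \<or> coord p a + coord r a + coord m a = - 1"
  using coord_sum[of a] by (cases p; cases r; cases m; auto)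

text \<open>The three differences add up to 0 and their bounds to 3k. If k = 0, equality holds
  throughout and the floor sum is 1 modulo 3, hence neither 0 nor -1.\<close>

lemma tri_empty:
  assumes "distinct [p, r, m]" "k \<le> 0"
  shows "a \<notin> tri k p r m"
  using coord_sum_distinct[OF assms(1), of a] assms(2) by (auto simp: tri_def; presburger)

lemma tri_simple:
  assumes "distinct [p, r, m]"
  shows "simple p a \<in> tri k p r m \<longleftrightarrow> a \<in> tri k p r m" "simple r a \<in> tri k p r m \<longleftrightarrow> a \<in> tri k p r m"
  using assms third_eq[OF assms] by (auto simp: tri_def coord_mirror)

text \<open>These equivalences make the recursion telescope: of its seven terms at a dominant
  alcove, six cancel in pairs and one is the triangle of size k.\<close>

lemma tri_dominant:
  assumes "distinct [p, r, m]" "coord p a \<ge> 0" "coord r a \<ge> 0" "k \<ge> 2"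
  shows "a \<in> tri (k - 1) m p r \<longleftrightarrow> a \<in> tri k p r m"
    "simple r a \<in> tri (k - 1) m p r \<longleftrightarrow> a \<in> tri (k - 2) r m p"
    "simple r (simple p a) \<in> tri (k - 1) m p r \<longleftrightarrow> simple p a \<in> tri (k - 2) r m p"
    "simple p (simple r a) \<in> tri (k - 2) r m p \<longleftrightarrow> a \<in> tri (k - 3) p r m"
  using assms third_eq[OF assms(1)] coord_sum_distinct[OF assms(1), of a]
  by (auto simp: tri_def coord_mirror)

text \<open>
  The functions of the triangles satisfy the recursion
  \<open>h\<^sub>k = e\<^sub>1 h\<^sub>k\<^sub>-\<^sub>1 - e\<^sub>2 h\<^sub>k\<^sub>-\<^sub>2 + e\<^sub>3 h\<^sub>k\<^sub>-\<^sub>3\<close> of the complete symmetric polynomials in three variables.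
\<close>

lemma triangle_fun_rec:
  assumes d: "distinct [p, r, m]" and k: "k \<ge> 2" and q: "\<alpha> * \<beta> = qq"
  shows "triangle_fun \<alpha> k p r m = (\<lambda>a. hecke2 \<alpha> \<beta> r p (triangle_fun \<alpha> (k - 1) m p r) a -
    qq * hecke2 \<alpha> \<beta> p r (triangle_fun \<alpha> (k - 2) r m p) a + qq ^ 3 * triangle_fun \<alpha> (k - 3) p r m a)"
proof (rule eq_if_eq_dominant[of _ p r])
  let ?X = "triangle_fun \<alpha> (k - 1) m p r" and ?Y = "triangle_fun \<alpha> (k - 2) r m p"
  have X: "?X (simple p a) = ?X a" for a
    using tri_simple(2)[of m p r a] d by (auto simp: triangle_fun_def)
  have Y: "?Y (simple r a) = ?Y a" for a
    using tri_simple(1)[of r m p a] d by (auto simp: triangle_fun_def)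
  have pr: "p \<noteq> r" "r \<noteq> p" using d by auto
  have T: "triangle_fun \<alpha> l p r m (simple p a) = triangle_fun \<alpha> l p r m a"
      "triangle_fun \<alpha> l p r m (simple r a) = triangle_fun \<alpha> l p r m a" for l a
    using tri_simple[OF d] by (simp_all add: triangle_fun_def)
  note inv = T hecke2_simple[of r p ?X, OF pr(2) X] hecke2_simple[of p r ?Y, OF pr(1) Y]
  show "triangle_fun \<alpha> k p r m (simple p a) = triangle_fun \<alpha> k p r m a"
    "triangle_fun \<alpha> k p r m (simple r a) = triangle_fun \<alpha> k p r m a" for a
    by (simp_all add: inv)
  show "hecke2 \<alpha> \<beta> r p ?X (simple p a) - qq * hecke2 \<alpha> \<beta> p r ?Y (simple p a) + qq ^ 3 * triangle_fun \<alpha> (k - 3) p r m (simple p a) =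
      hecke2 \<alpha> \<beta> r p ?X a - qq * hecke2 \<alpha> \<beta> p r ?Y a + qq ^ 3 * triangle_fun \<alpha> (k - 3) p r m a"
    "hecke2 \<alpha> \<beta> r p ?X (simple r a) - qq * hecke2 \<alpha> \<beta> p r ?Y (simple r a) + qq ^ 3 * triangle_fun \<alpha> (k - 3) p r m (simple r a) =
      hecke2 \<alpha> \<beta> r p ?X a - qq * hecke2 \<alpha> \<beta> p r ?Y a + qq ^ 3 * triangle_fun \<alpha> (k - 3) p r m a" for a
    by (simp_all only: inv)
  fix a assume a: "coord p a \<ge> 0" "coord r a \<ge> 0"
  note tri = tri_dominant[OF d a k]
  have "nat (2 * k + 1) = 2 + nat (2 * (k - 1) + 1)" "nat (2 * (k - 1) + 1) = 2 + nat (2 * (k - 2) + 1)"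
    using k by simp_all
  then have e: "\<alpha> ^ nat (2 * k + 1) = \<alpha> ^ 2 * \<alpha> ^ nat (2 * (k - 1) + 1)"
      "\<alpha> ^ nat (2 * (k - 1) + 1) = \<alpha> ^ 2 * \<alpha> ^ nat (2 * (k - 2) + 1)"
    by (simp_all only: power_add)
  \<comment> \<open>For k = 2 the size k - 3 is negative and the exponent is truncated, but both
    sides vanish.\<close>
  have e3: "triangle_fun \<alpha> (k - 3) p r m a * \<alpha> ^ 2 = of_bool (a \<in> tri (k - 3) p r m) * \<alpha> ^ nat (2 * (k - 2) + 1)"
  proof (cases "k \<ge> 3")
    case True
    then have "nat (2 * (k - 2) + 1) = nat (2 * (k - 3) + 1) + 2" by simp
    then show ?thesis by (simp add: triangle_fun_def power_add power2_eq_square)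
  next
    case False
    then have "a \<notin> tri (k - 3) p r m" by (intro tri_empty[OF d]) simp
    then show ?thesis by (simp add: triangle_fun_def)
  qed
  have e4: "qq ^ 3 * triangle_fun \<alpha> (k - 3) p r m a =
      qq * \<beta> ^ 2 * (of_bool (a \<in> tri (k - 3) p r m) * \<alpha> ^ nat (2 * (k - 2) + 1))"
    unfolding e3[symmetric] q[symmetric] by (simp add: power2_eq_square power3_eq_cube mult_ac)
  show "triangle_fun \<alpha> k p r m a = hecke2 \<alpha> \<beta> r p ?X a - qq * hecke2 \<alpha> \<beta> p r ?Y a +
      qq ^ 3 * triangle_fun \<alpha> (k - 3) p r m a"
    unfolding e4 hecke2_dominant[of r p ?X, OF pr(2) X a(2,1)] hecke2_dominant[of p r ?Y, OF pr(1) Y a]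
    unfolding triangle_fun_def tri e q[symmetric]
    by (simp add: algebra_simps power2_eq_square)
qed

text \<open>The smallest triangle is the parabolic subgroup of order 6 generated by
  \<open>simple p\<close> and \<open>simple r\<close>; the right side is C_p (C_r C_p - q).\<close>

lemma triangle_fun_1:
  assumes d: "distinct [p, r, m]"
  shows "triangle_fun \<alpha> 1 p r m = hecke2 \<alpha> \<beta> r p (hecke \<alpha> \<beta> p (\<lambda>a. of_bool (a = base_alcove)))"
proof (rule eq_if_eq_dominant[of _ p r])
  let ?X = "hecke \<alpha> \<beta> p (\<lambda>a. of_bool (a = base_alcove))"
  have X: "?X (simple p a) = ?X a" for a by (rule hecke_simple)
  have pr: "r \<noteq> p" using d by auto
  show "triangle_fun \<alpha> 1 p r m (simple p a) = triangle_fun \<alpha> 1 p r m a"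
    "triangle_fun \<alpha> 1 p r m (simple r a) = triangle_fun \<alpha> 1 p r m a" for a
    using tri_simple[OF d] by (simp_all add: triangle_fun_def)
  show "hecke2 \<alpha> \<beta> r p ?X (simple p a) = hecke2 \<alpha> \<beta> r p ?X a"
    "hecke2 \<alpha> \<beta> r p ?X (simple r a) = hecke2 \<alpha> \<beta> r p ?X a" for a
    using hecke2_simple[of r p ?X, OF pr X] by simp_all
  fix a assume a: "coord p a \<ge> 0" "coord r a \<ge> 0"
  have z: "coord i base_alcove = 0" for i by (cases i) simp_all
  have ne: "simple r a \<noteq> base_alcove" "simple p (simple r a) \<noteq> base_alcove"
      "simple r (simple p a) \<noteq> base_alcove" "simple p (simple r (simple p a)) \<noteq> base_alcove" "simple p a \<noteq> base_alcove"
    using a third_eq[OF d] d by (auto simp: mirror_eq_iff coord_mirror z)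
  have t: "a \<in> tri 1 p r m \<longleftrightarrow> a = base_alcove"
  proof
    assume "a \<in> tri 1 p r m"
    then have "coord p a = 0 \<and> coord r a = 0 \<and> coord m a = 0"
      using a coord_sum_distinct[OF d, of a] by (auto simp: tri_def)
    then have "coord i a = 0" for i using d by (cases i; cases p; cases r; cases m; simp)
    then show "a = base_alcove" by (simp add: alcove_eq_iff z)
  qed (simp add: tri_def z)
  show "triangle_fun \<alpha> 1 p r m a = hecke2 \<alpha> \<beta> r p ?X a"
    unfolding hecke2_dominant[of r p ?X, OF pr X a(2,1)]
  proof (cases "a = base_alcove")
    case True
    have "coord p (simple r base_alcove) = 0" "coord p (simple r (simple p base_alcove)) = 0"
      using third_eq[OF d] d by (auto simp: coord_mirror z)
    then show "triangle_fun \<alpha> 1 p r m a =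
        \<alpha>\<^sup>2 * ?X a + \<alpha> * \<beta> * ?X (simple r a) + \<beta>\<^sup>2 * ?X (simple r (simple p a))"
      using ne t unfolding True by (simp add: triangle_fun_def hecke_def z eval_nat_numeral)
  next
    case False
    then show "triangle_fun \<alpha> 1 p r m a =
        \<alpha>\<^sup>2 * ?X a + \<alpha> * \<beta> * ?X (simple r a) + \<beta>\<^sup>2 * ?X (simple r (simple p a))"
      using ne t by (simp add: triangle_fun_def hecke_def)
  qed
qed

lemma dual_base: "dual (\<lambda>a. of_bool (a = base_alcove)) (\<lambda>a. of_bool (a = base_alcove))"
  by (rule dualI[of "{base_alcove}"]) (auto simp: R_base)

lemma dual_triangle:
  "distinct [p, r, m] \<Longrightarrow> dual (triangle_fun 1 (int k) p r m) (triangle_fun qq (int k) p r m)"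
proof (induction k arbitrary: p r m rule: less_induct)
  case (less k)
  have zero: "dual (triangle_fun 1 l p r m) (triangle_fun qq l p r m)" if "distinct [p, r, m]" "l \<le> 0" for l p r m
    using tri_empty[OF that] by (intro dualI[of "{}"]) (auto simp: triangle_fun_def)
  have IH: "dual (triangle_fun 1 l p r m) (triangle_fun qq l p r m)" if "distinct [p, r, m]" "l < int k" for l p r m
    using zero[OF that(1), of l] less.IH[of "nat l" p r m] that by (cases "l \<le> 0") auto
  consider "k = 0" | "k = 1" | "k \<ge> 2" by linarith
  then show ?case
  proof cases
    case 1
    then show ?thesis using zero[OF less.prems] by simp
  next
    case 2
    then show ?thesis
      using dual_hecke2[OF dual_hecke[OF dual_base, of p], of r p]
        triangle_fun_1[OF less.prems, of 1 qq] triangle_fun_1[OF less.prems, of qq 1] by simp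
  next
    case 3
    then have k: "int k \<ge> 2" by simp
    have q: "1 * qq = qq" "qq * 1 = qq" by simp_all
    have d: "distinct [m, p, r]" "distinct [r, m, p]" using less.prems by auto
    have "dual (\<lambda>a. hecke2 1 qq r p (triangle_fun 1 (int k - 1) m p r) a -
          qq * hecke2 1 qq p r (triangle_fun 1 (int k - 2) r m p) a + qq ^ 3 * triangle_fun 1 (int k - 3) p r m a)
        (\<lambda>a. hecke2 qq 1 r p (triangle_fun qq (int k - 1) m p r) a -
          qq * hecke2 qq 1 p r (triangle_fun qq (int k - 2) r m p) a + qq ^ 3 * triangle_fun qq (int k - 3) p r m a)"
      by (intro dual_add dual_diff dual_hecke2 dual_mult IH d less.prems) auto
    then show ?thesis
      unfolding triangle_fun_rec[OF less.prems k q(1)] triangle_fun_rec[OF less.prems k q(2)] by simp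
  qed
qed

text \<open>Cancelling q to the power \<open>len u\<close> in \<open>dual_triangle\<close> gives the
  reversal identity for the constant column 1, and columns are unique.\<close>

lemma spiral_smooth:
  assumes "k \<ge> 1" "ble u (Alcove (- int k) (- 1) True)"
  shows "KL_poly (Alcove (- int k) (- 1) True) u = 1"
proof -
  let ?y = "Alcove (- int k) (- 1) True"
  have T: "tri (int k) N0 N1 N2 = {a. ble a ?y}"
    using cubulates_spiral[OF assms(1)] spiral_image[OF assms(1)] base_ble
    by (simp add: cubulates_def ints_def tri_def triangle_def)
  have ly: "len ?y = 2 * k + 1" using assms(1) by (simp add: len_def nat_add_distrib)
  have "KL_column ?y (\<lambda>_. 1)"
    unfolding KL_column_def
  proof (intro conjI allI impI)
    fix u assume u: "ble u ?y \<and> u \<noteq> ?y"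
    then show "2 * Polynomial.degree (1 :: int poly) < len ?y - len u"
      using ble_len_less[of u ?y] by simp
  next
    fix u assume u: "ble u ?y"
    have "qq ^ len u * (\<Sum>a\<in>{a. ble a ?y}. triangle_fun 1 (int k) N0 N1 N2 a * R u a) =
        triangle_fun qq (int k) N0 N1 N2 u"
      by (rule dual_sum[OF dual_triangle finite_ble]) (auto simp: triangle_fun_def T)
    also have "(\<Sum>a\<in>{a. ble a ?y}. triangle_fun 1 (int k) N0 N1 N2 a * R u a) = (\<Sum>a\<in>ints u ?y. R u a)"
      using R_support by (intro sum.mono_neutral_cong_right finite_ble) (auto simp: triangle_fun_def T ints_def)
    also have "triangle_fun qq (int k) N0 N1 N2 u = qq ^ len ?y"
      using u by (simp add: triangle_fun_def T ly nat_add_distrib nat_mult_distrib)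
    also have "\<dots> = qq ^ len u * qq ^ (len ?y - len u)"
      using ble_len_le[OF u] by (simp add: power_add[symmetric])
    finally have "(\<Sum>a\<in>ints u ?y. R u a) = qq ^ (len ?y - len u)"
      by (subst (asm) mult_left_cancel) auto
    then show "q_reverse (len ?y - len u) 1 = (\<Sum>a\<in>ints u ?y. R u a * 1)"
      by (simp add: q_reverse_def monom_altdef)
  qed simp
  from KL_column_unique[OF KL_column_KL_poly this assms(2)] show ?thesis .
qed

section \<open>Diagram automorphisms and conclusion\<close>

lemma ex_sorting:
  fixes f :: "node \<Rightarrow> int"
  shows "\<exists>\<pi>. bij \<pi> \<and> f (\<pi> N0) \<le> f (\<pi> N1) \<and> f (\<pi> N1) \<le> f (\<pi> N2)"
proof -
  have *: "\<exists>\<pi>. bij \<pi> \<and> f (\<pi> N0) \<le> f (\<pi> N1) \<and> f (\<pi> N1) \<le> f (\<pi> N2)"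
    if "distinct [i, j, k]" "f i \<le> f j" "f j \<le> f k" for i j k
  proof -
    let ?\<pi> = "case_node i j k"
    have "inj ?\<pi>" using that(1) by (intro injI) (auto split: node.splits)
    then have "bij ?\<pi>" by (simp add: bij_def finite_UNIV_inj_surj)
    then show ?thesis using that(2,3) by (intro exI[of _ ?\<pi>]) simp
  qed
  show ?thesis
    using *[of N0 N1 N2] *[of N0 N2 N1] *[of N1 N0 N2] *[of N1 N2 N0] *[of N2 N0 N1] *[of N2 N1 N0]
    by simp (meson linear)
qed

lemma third_permute: "inj \<pi> \<Longrightarrow> third (\<pi> i) (\<pi> j) = \<pi> (third i j)"
  using injD[of \<pi> N0 N1] injD[of \<pi> N0 N2] injD[of \<pi> N1 N2]
  by (cases "\<pi> N0"; cases "\<pi> N1"; cases "\<pi> N2"; cases i; cases j; simp)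

text \<open>Appending a letter applies the simple reflection of its label under each labelling, and
  reflections commute with permuting coordinates.\<close>

lemma (in A2_tilde) alc_permute:
  assumes "bij \<pi>" "x \<in> carrier W"
  shows "coord i (A2_tilde.alc W S (s \<circ> \<pi>) x) = coord (\<pi> i) (alc x)"
proof -
  define t where "t = s \<circ> \<pi>"
  interpret P: A2_tilde W S t
    using cox type bij_betw_trans[OF assms(1) s] unfolding t_def by unfold_locales
  obtain ws where ws: "ws \<in> lists S" "word_prod W ws = x" using ex_word[OF assms(2)] by blast
  have "coord i (P.alc (word_prod W ws)) = coord (\<pi> i) (alc (word_prod W ws))" for i
    using ws(1)
  proof (induction ws arbitrary: i rule: rev_induct)
    case Nil
    have "coord i base_alcove = 0" for i by (cases i) simp_all
    then show ?case by simp
  next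
    case (snoc y ws)
    obtain j where j: "y = t j"
      using snoc.prems P.S_cases[of y] by auto
    have app: "word_prod W (ws @ [y]) = word_prod W ws \<otimes> y"
      using snoc.prems S_carrier by (auto simp: word_prod_append)
    have "P.alc (word_prod W ws \<otimes> y) = simple j (P.alc (word_prod W ws))"
      using snoc.prems unfolding j by (intro P.alc_mult_s) simp
    moreover have "alc (word_prod W ws \<otimes> y) = simple (\<pi> j) (alc (word_prod W ws))"
      using snoc.prems alc_mult_s[of "word_prod W ws" "\<pi> j"] unfolding j by (simp add: t_def)
    ultimately show ?case
      using snoc bij_is_inj[OF assms(1)] unfolding app
      by (simp add: coord_mirror third_permute inj_eq)
  qed
  then show ?thesis using ws unfolding t_def by blast
qed

theorem theoremD:
  fixes W :: "('a, 'b) monoid_scheme" and S :: "'a set"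
  assumes "coxeter_system W S" and "type_A2_tilde W S"
  shows "infinite {y \<in> carrier W. \<forall>x. bruhat_le W S x y \<longrightarrow> KL_polynomial W S x y = 1} \<and>
    (\<forall>y\<in>carrier W. (\<forall>x. bruhat_le W S x y \<longrightarrow> KL_polynomial W S x y = 1) \<longrightarrow>
      can_be_cubulated (bruhat_interval_graph W S \<one>\<^bsub>W\<^esub> y))"
proof (intro conjI ballI impI)
  have card: "card (UNIV :: node set) = card S"
    using assms(2) by (simp add: UNIV_node type_A2_tilde_def)
  then have "finite S" using UNIV_node by (metis card.infinite card_eq_0_iff finite UNIV_not_empty)
  then obtain s :: "node \<Rightarrow> 'a" where s: "bij_betw s UNIV S"
    using card finite_same_card_bij[of "UNIV :: node set" S] by auto
  then interpret A2_tilde W S s using assms by unfold_locales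
  let ?y = "\<lambda>k. elt (Alcove (- int (Suc k)) (- 1) True)"
  have infinite_family: "\<forall>x. bruhat_le W S x (?y k) \<longrightarrow> KL_polynomial W S x (?y k) = 1" for k
    using spiral_smooth[of "Suc k"] by (subst rationally_smooth_iff) (simp_all del: of_nat_Suc)
  have "range ?y \<subseteq> {y \<in> carrier W. \<forall>x. bruhat_le W S x y \<longrightarrow> KL_polynomial W S x y = 1}"
    by (intro image_subsetI CollectI conjI elt_closed infinite_family)
  moreover have "inj ?y"
    by (rule injI) (metis alc_elt alcove.inject neg_equal_iff_equal of_nat_eq_iff Suc_inject)
  ultimately show "infinite {y \<in> carrier W. \<forall>x. bruhat_le W S x y \<longrightarrow> KL_polynomial W S x y = 1}"
    by (meson finite_subset range_inj_infinite)
  fix y assume y: "y \<in> carrier W" and smooth: "\<forall>x. bruhat_le W S x y \<longrightarrow> KL_polynomial W S x y = 1"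
  obtain \<pi> :: "node \<Rightarrow> node" where \<pi>: "bij \<pi>" and
      sorted: "coord (\<pi> N0) (alc y) \<le> coord (\<pi> N1) (alc y)" "coord (\<pi> N1) (alc y) \<le> coord (\<pi> N2) (alc y)"
    using ex_sorting[of "\<lambda>i. coord i (alc y)"] by blast
  \<comment> \<open>Under the new labelling the alcove of \<open>y\<close> has sorted floors, while
    the order, the polynomials and the graph depend on \<open>W\<close> and \<open>S\<close>
    only.\<close>
  interpret P: A2_tilde W S "s \<circ> \<pi>"
    using assms bij_betw_trans[OF \<pi> s] by unfold_locales
  have "coord i (P.alc y) = coord (\<pi> i) (alc y)" for i
    using alc_permute[OF \<pi> y] by simp
  then have "P.alc y \<in> smooth_alcoves"
    using smooth_classification[of "P.alc y"] card_arcs[of "P.alc y"] P.rationally_smooth_iff[OF y] smooth sorted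
    by auto
  then show "can_be_cubulated (bruhat_interval_graph W S \<one>\<^bsub>W\<^esub> y)"
    using smooth_cubulates P.cubulates_imp[OF _ _ y] by blast
qed

end
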